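(* Let $\mathcal{X}$ and $\mathcal{Y}$ be separable Hilbert spaces and let $U$ on $\mathcal{X}$ and $V$ on $\mathcal{Y}$ be operators. Then the following are equivalent: $U$ and $V$ are Schur coupled; $U$ and $V$ are matricially coupled; $U$ and $V$ are equivalent after extension.
   Context: "Operator" means bounded linear operator; an operator "on $\mathcal{X}$" maps $\mathcal{X}$ into $\mathcal{X}$; an operator is invertible if it is bijective with bounded inverse. $\dotplus$ denotes the direct sum of Banach spaces. Let $U$ on $\mathcal{X}$ and $V$ on $\mathcal{Y}$ be Banach space operators (in particular, these notions apply to Hilbert space operators). (Schur coupling) $U$ and $V$ are Schur coupled if there exists an operator matrix $S=\begin{bmatrix} A & B \\ C & D \end{bmatrix}$ on $\mathcal{X}\dotplus\mathcal{Y}$ with $A$ and $D$ invertible, $U=A-BD^{-1}C$ and $V=D-CA^{-1}B$. (Equivalence after extension) $U$ and $V$ are equivalent after extension if there exist Banach spaces $\mathcal{X}_0$ and $\mathcal{Y}_0$ and invertible operators $E:\mathcal{Y}\dotplus\mathcal{Y}_0\to\mathcal{X}\dotplus\mathcal{X}_0$ and $F:\mathcal{X}\dotplus\mathcal{X}_0\to\mathcal{Y}\dotplus\mathcal{Y}_0$ such that $\begin{bmatrix} U & 0 \\ 0 & I_{\mathcal{X}_0} \end{bmatrix}=E\begin{bmatrix} V & 0 \\ 0 & I_{\mathcal{Y}_0} \end{bmatrix}F$. (Matricial coupling) $U$ and $V$ are matricially coupled if there exists an invertible operator $\widehat{U}=\begin{bmatrix} U_{11} & U_{12} \\ U_{21}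 & U_{22} \end{bmatrix}$ on $\mathcal{X}\dotplus\mathcal{Y}$ with inverse $\widehat{U}^{-1}=\begin{bmatrix} V_{11} & V_{12} \\ V_{21} & V_{22} \end{bmatrix}$ on $\mathcal{X}\dotplus\mathcal{Y}$ such that $U=U_{11}$ and $V=V_{22}$. *)

theory Defs
  imports "HOL-Analysis.Analysis"
begin

(* The scalar field is the real or the complex numbers: by Frobenius, these are up to
   isometric isomorphism the only fields in the class below, and its axioms force sconj
   to be the identity, respectively complex conjugation. *)

class real_or_complex = real_normed_field + euclidean_space +
  fixes sconj :: "'a \<Rightarrow> 'a"
  assumes sconj_zero: "sconj 0 = 0"
    and sconj_mult_self: "sconj c * c = (norm c)\<^sup>2 *\<^sub>R 1"

instantiation real :: real_or_complex
begin
definition sconj_real :: "real \<Rightarrow> real" where "sconj_real c = c"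
instance by standard (simp_all add: sconj_real_def power2_eq_square)
end

instantiation complex :: real_or_complex
begin
definition sconj_complex :: "complex \<Rightarrow> complex" where "sconj_complex c = cnj c"
instance
proof
  fix c :: complex
  show "sconj c * c = (norm c)\<^sup>2 *\<^sub>R 1"
    by (simp add: sconj_complex_def scaleR_conv_of_real complex_norm_square mult.commute
        flip: of_real_power)
qed (simp add: sconj_complex_def)
end

(* The class banach supplies the norm, its completeness and the real multiples; scale is
   the multiplication by scalars in the given field. *)

locale banach_space = vector_space scale
  for scale :: "'k::real_or_complex \<Rightarrow> 'v::banach \<Rightarrow> 'v" +
  assumes scale_of_real: "scale (of_real r) x = r *\<^sub>R x"
    and norm_scale: "norm (scale c x) = norm c * norm x"

locale hilbert_space = banach_space scale
  for scale :: "'k::real_or_complex \<Rightarrow> 'v::banach \<Rightarrow> 'v" +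
  fixes ip :: "'v \<Rightarrow> 'v \<Rightarrow> 'k"
  assumes ip_add_left: "ip (x + y) z = ip x z + ip y z"
    and ip_scale_left: "ip (scale c x) z = c * ip x z"
    and ip_conj: "ip y x = sconj (ip x y)"
    and ip_self: "ip x x = of_real ((norm x)\<^sup>2)"

lemma hilbert_space_real:
  "hilbert_space (*\<^sub>R) (inner :: 'v::{real_inner, banach} \<Rightarrow> 'v \<Rightarrow> real)"
proof
  fix x y :: 'v
  show "inner y x = sconj (inner x y)"
    by (simp add: sconj_real_def inner_commute)
qed (simp_all add: scaleR_add_right scaleR_add_left inner_add_left power2_norm_eq_inner)

lemma hilbert_space_complex: "hilbert_space (*) (\<lambda>x y :: complex. x * cnj y)"
proof
  fix x y :: complex
  show "x * cnj x = of_real ((norm x)\<^sup>2)"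
    by (rule complex_norm_square [symmetric])
  show "y * cnj x = sconj (x * cnj y)"
    by (simp add: sconj_complex_def)
qed (simp_all add: distrib_left distrib_right scaleR_conv_of_real norm_mult)

locale separable_hilbert_space = hilbert_space scale ip
  for scale :: "'k::real_or_complex \<Rightarrow> 'v::banach \<Rightarrow> 'v" and ip :: "'v \<Rightarrow> 'v \<Rightarrow> 'k" +
  assumes separable: "separable_space (euclidean :: 'v topology)"

(* The direct sum of two Banach spaces is the product type with its library norm; the
   scalar multiplication is the one of the library's product of modules. *)

abbreviation dsum ::
    "('k::real_or_complex \<Rightarrow> 'v::banach \<Rightarrow> 'v) \<Rightarrow> ('k \<Rightarrow> 'w::banach \<Rightarrow> 'w)
      \<Rightarrow> 'k \<Rightarrow> 'v \<times> 'w \<Rightarrow> 'v \<times> 'w"  (infixr "\<oplus>\<^sub>s" 65)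
  where "dsum \<equiv> module_prod.scale"

(* Bounded linear operators from a subspace S of one Banach space to a subspace T of another;
   nothing is said about values outside S. *)

definition operator_on ::
    "('k::real_or_complex \<Rightarrow> 'v::banach \<Rightarrow> 'v) \<Rightarrow> 'v set \<Rightarrow> ('k \<Rightarrow> 'w::banach \<Rightarrow> 'w) \<Rightarrow> 'w set
      \<Rightarrow> ('v \<Rightarrow> 'w) \<Rightarrow> bool" where
  "operator_on s S t T f \<longleftrightarrow>
     f \<in> S \<rightarrow> T \<and>
     (\<forall>x\<in>S. \<forall>y\<in>S. f (x + y) = f x + f y) \<and>
     (\<forall>c. \<forall>x\<in>S. f (s c x) = t c (f x)) \<and>
     (\<exists>K. \<forall>x\<in>S. norm (f x) \<le> norm x * K)"

definition invertible_on ::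
    "('k::real_or_complex \<Rightarrow> 'v::banach \<Rightarrow> 'v) \<Rightarrow> 'v set \<Rightarrow> ('k \<Rightarrow> 'w::banach \<Rightarrow> 'w) \<Rightarrow> 'w set
      \<Rightarrow> ('v \<Rightarrow> 'w) \<Rightarrow> bool" where
  "invertible_on s S t T f \<longleftrightarrow>
     operator_on s S t T f \<and> bij_betw f S T \<and> operator_on t T s S (inv_into S f)"

abbreviation operator ::
    "('k::real_or_complex \<Rightarrow> 'v::banach \<Rightarrow> 'v) \<Rightarrow> ('k \<Rightarrow> 'w::banach \<Rightarrow> 'w) \<Rightarrow> ('v \<Rightarrow> 'w) \<Rightarrow> bool"
  where "operator s t \<equiv> operator_on s UNIV t UNIV"

abbreviation invertible_operator ::
    "('k::real_or_complex \<Rightarrow> 'v::banach \<Rightarrow> 'v) \<Rightarrow> ('k \<Rightarrow> 'w::banach \<Rightarrow> 'w) \<Rightarrow> ('v \<Rightarrow> 'w) \<Rightarrow> bool"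
  where "invertible_operator s t \<equiv> invertible_on s UNIV t UNIV"

lemma operator_iff_linear:
  assumes "banach_space s" "banach_space t"
  shows "operator s t f \<longleftrightarrow> Vector_Spaces.linear s t f \<and> (\<exists>K. \<forall>x. norm (f x) \<le> norm x * K)"
proof -
  have vs: "vector_space s" "vector_space t"
    using assms by (simp_all add: banach_space_def)
  have "Vector_Spaces.linear s t f \<longleftrightarrow>
      (\<forall>x y. f (x + y) = f x + f y) \<and> (\<forall>c x. f (s c x) = t c (f x))"
    using vs by (simp add: Vector_Spaces.linear_def module_hom_def module_hom_axioms_def
        module_iff_vector_space)
  then show ?thesis
    by (simp add: operator_on_def)
qed

lemma operator_real_iff_bounded_linear: "operator (*\<^sub>R) (*\<^sub>R) f \<longleftrightarrow> bounded_linear f"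
  by (simp add: operator_on_def bounded_linear_def bounded_linear_axioms_def linear_iff)

definition op_matrix ::
    "('a \<Rightarrow> 'c) \<Rightarrow> ('b \<Rightarrow> 'c) \<Rightarrow> ('a \<Rightarrow> 'd) \<Rightarrow> ('b \<Rightarrow> 'd) \<Rightarrow> 'a \<times> 'b \<Rightarrow> 'c::plus \<times> 'd::plus" where
  "op_matrix A B C D = (\<lambda>(x, y). (A x + B y, C x + D y))"

definition is_op_matrix ::
    "('k::real_or_complex \<Rightarrow> 'x::banach \<Rightarrow> 'x) \<Rightarrow> ('k \<Rightarrow> 'y::banach \<Rightarrow> 'y)
      \<Rightarrow> ('x \<Rightarrow> 'x) \<Rightarrow> ('y \<Rightarrow> 'x) \<Rightarrow> ('x \<Rightarrow> 'y) \<Rightarrow> ('y \<Rightarrow> 'y) \<Rightarrow> ('x \<times> 'y \<Rightarrow> 'x \<times> 'y) \<Rightarrow> bool" where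
  "is_op_matrix sX sY A B C D S \<longleftrightarrow>
     operator sX sX A \<and> operator sY sX B \<and> operator sX sY C \<and> operator sY sY D \<and>
     operator (sX \<oplus>\<^sub>s sY) (sX \<oplus>\<^sub>s sY) S \<and> S = op_matrix A B C D"

definition schur_coupled ::
    "('k::real_or_complex \<Rightarrow> 'x::banach \<Rightarrow> 'x) \<Rightarrow> ('k \<Rightarrow> 'y::banach \<Rightarrow> 'y)
      \<Rightarrow> ('x \<Rightarrow> 'x) \<Rightarrow> ('y \<Rightarrow> 'y) \<Rightarrow> bool" where
  "schur_coupled sX sY U V \<longleftrightarrow>
     (\<exists>A B C D S. is_op_matrix sX sY A B C D S \<and>
        invertible_operator sX sX A \<and> invertible_operator sY sY D \<and>
        U = (\<lambda>x. A x - B (inv D (C x))) \<and> V = (\<lambda>y. D y - C (inv A (B y))))"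

definition matricially_coupled ::
    "('k::real_or_complex \<Rightarrow> 'x::banach \<Rightarrow> 'x) \<Rightarrow> ('k \<Rightarrow> 'y::banach \<Rightarrow> 'y)
      \<Rightarrow> ('x \<Rightarrow> 'x) \<Rightarrow> ('y \<Rightarrow> 'y) \<Rightarrow> bool" where
  "matricially_coupled sX sY U V \<longleftrightarrow>
     (\<exists>Uhat U11 U12 U21 U22 V11 V12 V21 V22.
        invertible_operator (sX \<oplus>\<^sub>s sY) (sX \<oplus>\<^sub>s sY) Uhat \<and>
        is_op_matrix sX sY U11 U12 U21 U22 Uhat \<and>
        is_op_matrix sX sY V11 V12 V21 V22 (inv Uhat) \<and>
        U = U11 \<and> V = V22)"

(* A formula cannot quantify over all Banach spaces, so the extension spaces X0 and Y0 range
   over the closed subspaces of a Banach space W passed as a parameter (with scalar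
   multiplication sW).  No Banach space is excluded if W is arbitrary: given Banach spaces
   X0 and Y0, both are closed subspaces of their direct sum.  Conversely, W must be
   large enough to supply the extension spaces one needs. *)

definition equivalent_after_extension ::
    "('k::real_or_complex \<Rightarrow> 'w::banach \<Rightarrow> 'w)
      \<Rightarrow> ('k \<Rightarrow> 'x::banach \<Rightarrow> 'x) \<Rightarrow> ('k \<Rightarrow> 'y::banach \<Rightarrow> 'y)
      \<Rightarrow> ('x \<Rightarrow> 'x) \<Rightarrow> ('y \<Rightarrow> 'y) \<Rightarrow> bool" where
  "equivalent_after_extension sW sX sY U V \<longleftrightarrow>
     (\<exists>X0 Y0 E F.
        module.subspace sW X0 \<and> closed X0 \<and> module.subspace sW Y0 \<and> closed Y0 \<and>
        invertible_on (sY \<oplus>\<^sub>s sW) (UNIV \<times> Y0) (sX \<oplus>\<^sub>s sW) (UNIV \<times> X0) E \<and>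
        invertible_on (sX \<oplus>\<^sub>s sW) (UNIV \<times> X0) (sY \<oplus>\<^sub>s sW) (UNIV \<times> Y0) F \<and>
        (\<forall>z \<in> UNIV \<times> X0.
           op_matrix U (\<lambda>_. 0) (\<lambda>_. 0) id z = E (op_matrix V (\<lambda>_. 0) (\<lambda>_. 0) id (F z))))"

end

theory Submission
  imports Defs
begin

text \<open>
  The links between equivalence after extension and matricial coupling, and the passage from Schur
  coupling to matricial coupling, are explicit formulas for block matrices and hold in all
  Banach spaces. The substance is that matricial coupling implies Schur coupling in
  separable Hilbert spaces.

  Let \<open>[U U12; U21 U22]\<close> be invertible with inverse \<open>[V11 V12; V21 V]\<close>. If the corner \<open>U22\<close> is
  invertible, then \<open>U\<close> and \<open>V\<close> are Schur coupled, with \<open>A\<close> the Schur complement of \<open>U22\<close> and \<open>D\<close> its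
  inverse (\<open>schur_coupled_if_corner_invertible\<close>). Block triangular factors change the corner to
  \<open>U22 + R U12 + U21 T + R U T\<close> for arbitrary \<open>R\<close> and \<open>T\<close> and leave \<open>U\<close> and \<open>V\<close> untouched
  (\<open>shift\<close>), so it suffices to find \<open>R\<close> and \<open>T\<close> that make this operator invertible. There are
  two cases.

  If \<open>U\<close> is bounded below on an infinite-dimensional closed subspace, that subspace contains a copy of
  the separable space \<open>Y\<close>; hence there are \<open>T\<close> and \<open>R\<close> with \<open>R U T = 1\<close>, and large multiples of them
  make the term \<open>R U T\<close> dominate (\<open>schur_coupled_if_bounded_below\<close>). The same works with
  \<open>V\<close> in place of \<open>U\<close>, by symmetry.

  If neither \<open>U\<close> nor \<open>V\<close> is bounded below on such a subspace (in a Hilbert space this says that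
  both are compact), the relations \<open>V11 U + V12 U21 = 1\<close> and \<open>U21 V12 + U22 V = 1\<close> force
  \<open>U21\<close> to be a Fredholm operator (\<open>schur_coupled_if_not_bounded_below\<close>). With \<open>R = 0\<close> and \<open>T\<close> a large
  multiple of an inverse of \<open>U21\<close> modulo operators of finite rank, the corner becomes an invertible
  operator minus one of finite rank. Since the ranges of \<open>U21\<close> and of the corner together span
  \<open>Y\<close>, the finite rank defect can be removed by changing \<open>T\<close>, one rank at a time
  (\<open>obtain_invertible_completion\<close>).

  Separability enters through the Gram-Schmidt process for a dense sequence. It replaces both the
  projection onto a closed range and the choice of an orthonormal basis: all operators with
  prescribed behaviour are limits of finite Fourier sums (\<open>obtain_operator_from_fourier_sums\<close>).
\<close>

section \<open>Calculus of operators over the scalar field\<close>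

text \<open>Introduction rules for operators. Composition is left out: as a rule for \<open>\<lambda>x. g (f x)\<close> it
  unifies with every goal, so it is only applied with \<open>g\<close> fixed (\<open>operator_compose\<close> with a fact
  about \<open>g\<close>).\<close>

named_theorems operator_intros

lemma banach_space_module: "banach_space s \<Longrightarrow> module s"
  by (simp add: banach_space_def module_iff_vector_space)

lemma dsum_apply:
  assumes "banach_space s" "banach_space t"
  shows "(s \<oplus>\<^sub>s t) c z = (s c (fst z), t c (snd z))"
  using assms by (simp add: module_prod.scale_def module_prod_def module_pair_def banach_space_module)

lemma banach_space_zero: "banach_space s \<Longrightarrow> s c 0 = 0"
  by (simp add: banach_space_module module.scale_zero_right)

lemma banach_space_add: "banach_space s \<Longrightarrow> s c (x + y) = s c x + s c y"
  by (simp add: banach_space_module module.scale_right_distrib)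

lemma banach_space_diff: "banach_space s \<Longrightarrow> s c (x - y) = s c x - s c y"
  by (simp add: banach_space_module module.scale_right_diff_distrib)

lemma banach_space_scaleR:
  assumes "banach_space s" shows "s c (r *\<^sub>R x) = r *\<^sub>R s c x"
proof -
  interpret banach_space s by (rule assms)
  show ?thesis by (metis scale_left_commute scale_of_real)
qed

lemma banach_space_dsum:
  fixes s :: "'k::real_or_complex \<Rightarrow> 'v::banach \<Rightarrow> 'v" and t :: "'k \<Rightarrow> 'w::banach \<Rightarrow> 'w"
  assumes "banach_space s" "banach_space t"
  shows "banach_space (s \<oplus>\<^sub>s t)"
proof -
  interpret s: banach_space s by (rule assms)
  interpret t: banach_space t by (rule assms)
  show ?thesis
  proof
    fix c :: 'k and x :: "'v \<times> 'w"
    have "(norm c * norm (fst x))\<^sup>2 + (norm c * norm (snd x))\<^sup>2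
        = (norm c)\<^sup>2 * ((norm (fst x))\<^sup>2 + (norm (snd x))\<^sup>2)"
      by (simp add: algebra_simps power_mult_distrib)
    then show "norm ((s \<oplus>\<^sub>s t) c x) = norm c * norm x"
      by (simp add: dsum_apply assms norm_prod_def s.norm_scale t.norm_scale real_sqrt_mult)
  qed (auto simp: dsum_apply assms s.scale_of_real t.scale_of_real s.scale_right_distrib
      t.scale_right_distrib s.scale_left_distrib t.scale_left_distrib prod_eq_iff)
qed

lemma banach_space_field: "banach_space ((*) :: 'k::real_or_complex \<Rightarrow> 'k \<Rightarrow> 'k)"
  by standard (auto simp: algebra_simps norm_mult scaleR_conv_of_real)

lemma operator_on_compose:
  assumes f: "operator_on s S t T f" and g: "operator_on t T u W g"
  shows "operator_on s S u W (\<lambda>x. g (f x))"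
proof -
  from f obtain K where K: "\<And>x. x \<in> S \<Longrightarrow> norm (f x) \<le> norm x * K"
    unfolding operator_on_def by blast
  from g obtain L where L: "\<And>x. x \<in> T \<Longrightarrow> norm (g x) \<le> norm x * L"
    unfolding operator_on_def by blast
  have "norm (g (f x)) \<le> norm x * (\<bar>K\<bar> * \<bar>L\<bar>)" if "x \<in> S" for x
  proof -
    have "f x \<in> T"
      using f that by (auto simp: operator_on_def)
    then have "norm (g (f x)) \<le> norm (f x) * \<bar>L\<bar>"
      using L[of "f x"] mult_left_mono[of L "\<bar>L\<bar>" "norm (f x)"] by force
    also have "\<dots> \<le> (norm x * \<bar>K\<bar>) * \<bar>L\<bar>"
      using order_trans[OF K[OF that] mult_left_mono[OF abs_ge_self norm_ge_zero]]
      by (intro mult_right_mono) auto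
    finally show ?thesis by (simp add: mult.assoc)
  qed
  then show ?thesis
    using f g by (auto simp: operator_on_def Pi_iff)
qed

lemma operator_iff_bounded_linear:
  assumes "banach_space s" "banach_space t"
  shows "operator s t f \<longleftrightarrow> bounded_linear f \<and> (\<forall>c x. f (s c x) = t c (f x))"
proof -
  interpret s: banach_space s by (rule assms)
  interpret t: banach_space t by (rule assms)
  have "f (r *\<^sub>R x) = r *\<^sub>R f x" if "\<forall>c x. f (s c x) = t c (f x)" for r x
    using that by (metis s.scale_of_real t.scale_of_real)
  then show ?thesis
    by (auto simp: operator_on_def bounded_linear_def bounded_linear_axioms_def linear_iff)
qed

lemma operator_scaleR_commute:
  assumes "operator s t f" "banach_space s" "banach_space t"
  shows "f (r *\<^sub>R x) = r *\<^sub>R f x"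
  using assms by (simp add: operator_iff_bounded_linear bounded_linear.linear linear_scale)

lemma operator_add: "operator s t f \<Longrightarrow> f (x + y) = f x + f y"
  by (simp add: operator_on_def)

lemma operator_scale: "operator s t f \<Longrightarrow> f (s c x) = t c (f x)"
  by (simp add: operator_on_def)

lemma operator_additive: "operator s t f \<Longrightarrow> Modules.additive f"
  by (simp add: Modules.additive_def operator_add)

lemmas operator_zero = Modules.additive.zero [OF operator_additive]
  and operator_minus = Modules.additive.minus [OF operator_additive]
  and operator_diff = Modules.additive.diff [OF operator_additive]
  and operator_sum = Modules.additive.sum [OF operator_additive]

lemma operator_bound:
  assumes "operator s t f"
  obtains K where "K > 0" "\<And>x. norm (f x) \<le> K * norm x"
proof -
  obtain L where L: "\<And>x. norm (f x) \<le> norm x * L"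
    using assms by (auto simp: operator_on_def)
  have "norm (f x) \<le> (\<bar>L\<bar> + 1) * norm x" for x
    using order_trans[OF L[of x] mult_left_mono[of L "\<bar>L\<bar> + 1" "norm x"]]
    by (simp add: mult.commute)
  then show ?thesis
    by (intro that[of "\<bar>L\<bar> + 1"]) auto
qed

lemma operator_id: "banach_space s \<Longrightarrow> operator s s (\<lambda>x. x)"
  by (simp add: operator_iff_bounded_linear bounded_linear_ident)

context
  fixes s :: "'k::real_or_complex \<Rightarrow> 'v::banach \<Rightarrow> 'v"
    and t :: "'k \<Rightarrow> 'w::banach \<Rightarrow> 'w"
  assumes s: "banach_space s" and t: "banach_space t"
begin

lemma operator_const_zero: "operator s t (\<lambda>x. 0)"
  using s t by (simp add: operator_iff_bounded_linear banach_space_zero)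

lemma operator_plus:
  "operator s t f \<Longrightarrow> operator s t g \<Longrightarrow> operator s t (\<lambda>x. f x + g x)"
  using s t by (simp add: operator_iff_bounded_linear bounded_linear_add banach_space_add)

lemma operator_minus_op:
  "operator s t f \<Longrightarrow> operator s t g \<Longrightarrow> operator s t (\<lambda>x. f x - g x)"
  using s t by (simp add: operator_iff_bounded_linear bounded_linear_sub banach_space_diff)

lemma operator_uminus: "operator s t f \<Longrightarrow> operator s t (\<lambda>x. - f x)"
  using operator_minus_op[OF operator_const_zero] by simp

lemma operator_scaleR: "operator s t f \<Longrightarrow> operator s t (\<lambda>x. r *\<^sub>R f x)"
  using s t by (simp add: operator_iff_bounded_linear bounded_linear_const_scaleR banach_space_scaleR)

lemma operator_sum_op:
  "(\<And>i. i \<in> I \<Longrightarrow> operator s t (f i)) \<Longrightarrow> operator s t (\<lambda>x. \<Sum>i\<in>I. f i x)"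
  by (induction I rule: infinite_finite_induct) (auto intro!: operator_const_zero operator_plus)

lemma operator_Pair:
  assumes "banach_space u"
  shows "operator u s f \<Longrightarrow> operator u t g \<Longrightarrow> operator u (s \<oplus>\<^sub>s t) (\<lambda>x. (f x, g x))"
  using s t assms
  by (simp add: operator_iff_bounded_linear banach_space_dsum bounded_linear_Pair dsum_apply)

lemma operator_fst: "operator (s \<oplus>\<^sub>s t) s fst"
  and operator_snd: "operator (s \<oplus>\<^sub>s t) t snd"
  using s t
  by (simp_all add: operator_iff_bounded_linear banach_space_dsum bounded_linear_fst
      bounded_linear_snd dsum_apply)

lemma operator_rank_one:
  assumes f: "operator s (*) f"
  shows "operator s t (\<lambda>x. t (f x) a)"
proof -
  interpret t: banach_space t by (rule t)
  obtain K where K: "\<And>x. norm (f x) \<le> K * norm x"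
    using operator_bound[OF f] by metis
  have "norm (t (f x) a) \<le> norm x * (K * norm a)" for x
    using mult_right_mono[OF K[of x], of "norm a"] by (simp add: t.norm_scale mult_ac)
  then show ?thesis
    using f by (auto simp: operator_on_def t.scale_left_distrib)
qed

end

lemma operator_compose:
  "operator t u g \<Longrightarrow> operator s t f \<Longrightarrow> operator s u (\<lambda>x. g (f x))"
  by (rule operator_on_compose)

lemmas [operator_intros] =
  operator_id operator_const_zero operator_plus operator_minus_op
  operator_uminus operator_scaleR operator_sum_op operator_rank_one

lemma operator_on_subset:
  "operator s t f \<Longrightarrow> f ` S \<subseteq> T \<Longrightarrow> operator_on s S t T f"
  by (auto simp: operator_on_def)

lemma invertible_onI:
  assumes f: "operator_on s S t T f" and g: "operator_on t T s S g"
    and gf: "\<And>x. x \<in> S \<Longrightarrow> g (f x) = x" and fg: "\<And>y. y \<in> T \<Longrightarrow> f (g y) = y"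
    and T: "\<And>x y. x \<in> T \<Longrightarrow> y \<in> T \<Longrightarrow> x + y \<in> T"  "\<And>c x. x \<in> T \<Longrightarrow> t c x \<in> T"
  shows "invertible_on s S t T f"
proof -
  have bij: "bij_betw f S T"
    by (rule bij_betw_byWitness[where f' = g]) (use f g gf fg in \<open>auto simp: operator_on_def\<close>)
  have inv: "inv_into S f y = g y" if "y \<in> T" for y
    using that f g gf fg bij
    by (intro inv_into_f_eq) (auto simp: operator_on_def bij_betw_def)
  have "operator_on t T s S (inv_into S f)"
    using g T unfolding operator_on_def by (simp add: inv Pi_iff)
  with f bij show ?thesis by (simp add: invertible_on_def)
qed

lemma invertible_operatorI:
  assumes "operator s t f" "operator t s g" "\<And>x. g (f x) = x" "\<And>y. f (g y) = y"
  shows "invertible_operator s t f"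
  using assms by (intro invertible_onI) auto

lemma invertible_operatorE:
  assumes "invertible_operator s t f"
  obtains "operator s t f" "operator t s (inv f)" "\<And>x. inv f (f x) = x" "\<And>y. f (inv f y) = y"
  using assms bij_betw_inv_into_left[of f UNIV UNIV] bij_betw_inv_into_right[of f UNIV UNIV]
  by (auto simp: invertible_on_def)

text \<open>A multiple of the identity absorbs every smaller perturbation: solving
  \<open>r x + D x = z\<close> means finding the fixed point of the contraction \<open>x \<mapsto> (z - D x) / r\<close>.\<close>

lemma invertible_scaleR_plus:
  assumes s: "banach_space s" and D: "operator s s D"
    and bound: "\<And>x. norm (D x) \<le> K * norm x" and "K < r" and "0 \<le> K"
  shows "invertible_operator s s (\<lambda>x. r *\<^sub>R x + D x)"
proof -
  let ?f = "\<lambda>x. r *\<^sub>R x + D x"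
  have r: "r > 0" using assms by simp
  have ex1: "\<exists>!x. ?f x = z" for z
  proof -
    have "\<exists>!x. (1/r) *\<^sub>R (z - D x) = x"
    proof (rule banach_fix_type)
      show "0 \<le> K/r" "K/r < 1" using assms r by auto
      show "\<forall>x y. dist ((1/r) *\<^sub>R (z - D x)) ((1/r) *\<^sub>R (z - D y)) \<le> K/r * dist x y"
      proof (intro allI)
        fix x y
        have "dist ((1/r) *\<^sub>R (z - D x)) ((1/r) *\<^sub>R (z - D y)) = norm (D (y - x)) / r"
          using r by (simp add: dist_norm operator_diff[OF D] flip: scaleR_diff_right)
        also have "\<dots> \<le> K/r * dist x y"
          using bound[of "y - x"] r by (simp add: dist_norm norm_minus_commute field_simps)
        finally show "dist ((1/r) *\<^sub>R (z - D x)) ((1/r) *\<^sub>R (z - D y)) \<le> K/r * dist x y" .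
      qed
    qed
    moreover have "(1/r) *\<^sub>R (z - D x) = x \<longleftrightarrow> ?f x = z" for x
    proof -
      have "(1/r) *\<^sub>R (z - D x) = x \<longleftrightarrow> r *\<^sub>R ((1/r) *\<^sub>R (z - D x)) = r *\<^sub>R x"
        using r by (simp only: scaleR_cancel_left) simp
      also have "\<dots> \<longleftrightarrow> z - D x = r *\<^sub>R x"
        using r by simp
      finally show ?thesis by (auto simp: algebra_simps)
    qed
    ultimately show ?thesis by simp
  qed
  define g where "g z = (THE x. ?f x = z)" for z
  have fg: "?f (g z) = z" for z
    unfolding g_def using theI'[OF ex1] .
  have gf: "g (?f x) = x" for x
    using ex1 fg by metis
  have f: "operator s s ?f"
    by (intro operator_intros s D)
  have lower: "(r - K) * norm x \<le> norm (?f x)" for x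
    using bound[of x] r norm_triangle_ineq4[of "?f x" "D x"] by (simp add: algebra_simps)
  have "operator s s g"
    unfolding operator_on_def
  proof (intro conjI ballI allI)
    show "g (x + y) = g x + g y" for x y
      using gf[of "g x + g y"] fg[of x] fg[of y] operator_add[OF f, of "g x" "g y"] by simp
    show "g (s c x) = s c (g x)" for c x
      using gf[of "s c (g x)"] fg[of x] operator_scale[OF f, of c "g x"] by simp
    have "norm (g x) \<le> norm x * (1 / (r - K))" for x
      using lower[of "g x"] fg[of x] \<open>K < r\<close> by (simp add: field_simps)
    then show "\<exists>K. \<forall>x\<in>UNIV. norm (g x) \<le> norm x * K" by blast
  qed auto
  with f gf fg show ?thesis
    by (intro invertible_operatorI)
qed

text \<open>The Sherman-Morrison formula.\<close>

lemma invertible_rank_one_perturbation: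
  assumes s: "banach_space s" and J: "invertible_operator s s J" and \<phi>: "operator s (*) \<phi>"
    and ne: "\<phi> (inv J a) \<noteq> 1"
  shows "invertible_operator s s (\<lambda>x. J x - s (\<phi> x) a)"
proof -
  interpret banach_space s by (rule s)
  from J have Jop: "operator s s J" "operator s s (inv J)"
    and inv: "\<And>x. inv J (J x) = x" "\<And>x. J (inv J x) = x"
    by (auto elim: invertible_operatorE)
  define d where "d = 1 - \<phi> (inv J a)"
  have d: "d \<noteq> 0" using ne by (simp add: d_def)
  have phia: "\<phi> (inv J a) = 1 - d" by (simp add: d_def)
  let ?g = "\<lambda>y. inv J y + s (\<phi> (inv J y)) (s (1/d) (inv J a))"
  note lin = operator_add[OF Jop(1)] operator_add[OF Jop(2)] operator_diff[OF Jop(2)]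
    operator_scale[OF Jop(1)] operator_scale[OF Jop(2)] operator_add[OF \<phi>]
    operator_diff[OF \<phi>] operator_scale[OF \<phi>]
  show ?thesis
  proof (rule invertible_operatorI[where g = ?g])
    have \<phi>J: "operator s (*) (\<lambda>x. \<phi> (inv J x))"
      by (rule operator_on_compose[OF Jop(2) \<phi>])
    show "operator s s (\<lambda>x. J x - s (\<phi> x) a)" "operator s s ?g"
      by (rule operator_minus_op operator_plus operator_rank_one s Jop \<phi> \<phi>J)+
    fix x
    have "?g (J x - s (\<phi> x) a) = x + (s ((\<phi> x - \<phi> x * (1 - d)) * (1/d)) (inv J a) - s (\<phi> x) (inv J a))"
      by (simp add: lin inv phia)
    also have "(\<phi> x - \<phi> x * (1 - d)) * (1/d) = \<phi> x"
      using d by (simp add: field_simps)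
    finally show "?g (J x - s (\<phi> x) a) = x" by simp
    have "J (?g x) - s (\<phi> (?g x)) a
        = x + (s (\<phi> (inv J x) * (1/d)) a - s (\<phi> (inv J x) + \<phi> (inv J x) * ((1/d) * (1 - d))) a)"
      by (simp add: lin inv phia)
    also have "\<phi> (inv J x) + \<phi> (inv J x) * ((1/d) * (1 - d)) = \<phi> (inv J x) * (1/d)"
      using d by (simp add: field_simps)
    finally show "J (?g x) - s (\<phi> (?g x)) a = x" by simp
  qed
qed

section \<open>Matricial couplings\<close>

text \<open>The matrix \<open>[U U12; U21 U22]\<close> has the inverse \<open>[V11 V12; V21 V]\<close>; the assumptions are the
  eight entries of the two products, because all later arguments compute with single entries.\<close>

locale coupling =
  fixes sX :: "'k::real_or_complex \<Rightarrow> 'x::banach \<Rightarrow> 'x" and sY :: "'k \<Rightarrow> 'y::banach \<Rightarrow> 'y"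
    and U :: "'x \<Rightarrow> 'x" and U12 :: "'y \<Rightarrow> 'x" and U21 :: "'x \<Rightarrow> 'y" and U22 :: "'y \<Rightarrow> 'y"
    and V11 :: "'x \<Rightarrow> 'x" and V12 :: "'y \<Rightarrow> 'x" and V21 :: "'x \<Rightarrow> 'y" and V :: "'y \<Rightarrow> 'y"
  assumes X: "banach_space sX" and Y: "banach_space sY"
    and ops: "operator sX sX U" "operator sY sX U12" "operator sX sY U21" "operator sY sY U22"
      "operator sX sX V11" "operator sY sX V12" "operator sX sY V21" "operator sY sY V"
    and UV: "U (V11 x) + U12 (V21 x) = x" "U (V12 y) + U12 (V y) = 0"
      "U21 (V11 x) + U22 (V21 x) = 0" "U21 (V12 y) + U22 (V y) = y"
    and VU: "V11 (U x) + V12 (U21 x) = x" "V11 (U12 y) + V12 (U22 y) = 0"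
      "V21 (U x) + V (U21 x) = 0" "V21 (U12 y) + V (U22 y) = y"
begin

lemmas compose = ops[THEN operator_compose]

lemmas linear = ops[THEN operator_add] ops[THEN operator_diff] ops[THEN operator_minus]
  ops[THEN operator_zero]

lemma UV': "U (V11 x) = x - U12 (V21 x)" "U (V12 y) = - U12 (V y)"
    "U21 (V11 x) = - U22 (V21 x)" "U21 (V12 y) = y - U22 (V y)"
  using UV(1,3)[of x] UV(2,4)[of y] by (simp_all add: algebra_simps eq_neg_iff_add_eq_0)

lemma VU': "V11 (U x) = x - V12 (U21 x)" "V11 (U12 y) = - V12 (U22 y)"
    "V21 (U x) = - V (U21 x)" "V21 (U12 y) = y - V (U22 y)"
  using VU(1,3)[of x] VU(2,4)[of y] by (simp_all add: algebra_simps eq_neg_iff_add_eq_0)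

lemma swap: "coupling sY sX V V21 V12 V11 U22 U21 U12 U"
  using X Y ops UV VU by (intro coupling.intro) (auto simp: add.commute)

end

lemma operator_op_matrix:
  assumes "banach_space sX" "banach_space sY"
    and "operator sX sX A" "operator sY sX B" "operator sX sY C" "operator sY sY D"
  shows "operator (sX \<oplus>\<^sub>s sY) (sX \<oplus>\<^sub>s sY) (op_matrix A B C D)"
proof -
  note P = banach_space_dsum[OF assms(1,2)]
  note c = assms(3-6)[THEN operator_compose]
  show ?thesis
    unfolding op_matrix_def case_prod_beta
    by (intro operator_Pair operator_plus c assms P operator_fst operator_snd)
qed

lemma is_op_matrixI:
  assumes "banach_space sX" "banach_space sY"
    and "operator sX sX A" "operator sY sX B" "operator sX sY C" "operator sY sY D"
  shows "is_op_matrix sX sY A B C D (op_matrix A B C D)"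
  using assms by (simp add: is_op_matrix_def operator_op_matrix)

lemma matricially_coupled_iff:
  assumes "banach_space sX" "banach_space sY"
  shows "matricially_coupled sX sY U V \<longleftrightarrow>
    (\<exists>U12 U21 U22 V11 V12 V21. coupling sX sY U U12 U21 U22 V11 V12 V21 V)"
proof
  assume "matricially_coupled sX sY U V"
  then obtain S U12 U21 U22 V11 V12 V21
    where inv: "invertible_operator (sX \<oplus>\<^sub>s sY) (sX \<oplus>\<^sub>s sY) S"
      and U: "is_op_matrix sX sY U U12 U21 U22 S"
      and V: "is_op_matrix sX sY V11 V12 V21 V (inv S)"
    unfolding matricially_coupled_def by blast
  have op: "operator sX sX U" "operator sY sX U12" "operator sX sY U21" "operator sY sY U22"
      "operator sX sX V11" "operator sY sX V12" "operator sX sY V21" "operator sY sY V"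
    and S: "S = op_matrix U U12 U21 U22" "inv S = op_matrix V11 V12 V21 V"
    using U V by (auto simp: is_op_matrix_def)
  have "S (inv S z) = z" "inv S (S z) = z" for z
    using inv by (auto elim: invertible_operatorE)
  then have 1: "op_matrix U U12 U21 U22 (op_matrix V11 V12 V21 V z) = z"
    "op_matrix V11 V12 V21 V (op_matrix U U12 U21 U22 z) = z" for z
    unfolding S(2) unfolding S(1) by auto
  note zero = op[THEN operator_zero]
  have "coupling sX sY U U12 U21 U22 V11 V12 V21 V"
    using 1[of "(_, 0)"] 1[of "(0, _)"]
    by (intro coupling.intro assms op) (simp_all add: op_matrix_def zero)
  then show "\<exists>U12 U21 U22 V11 V12 V21. coupling sX sY U U12 U21 U22 V11 V12 V21 V"
    by blast
next
  assume "\<exists>U12 U21 U22 V11 V12 V21. coupling sX sY U U12 U21 U22 V11 V12 V21 V"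
  then obtain U12 U21 U22 V11 V12 V21 where "coupling sX sY U U12 U21 U22 V11 V12 V21 V"
    by blast
  then interpret coupling sX sY U U12 U21 U22 V11 V12 V21 V .
  let ?S = "op_matrix U U12 U21 U22" and ?T = "op_matrix V11 V12 V21 V"
  have ST: "?S (?T z) = z" for z
    by (simp add: op_matrix_def case_prod_beta linear UV' prod_eq_iff)
  have TS: "?T (?S z) = z" for z
    by (simp add: op_matrix_def case_prod_beta linear VU' prod_eq_iff)
  have S: "is_op_matrix sX sY U U12 U21 U22 ?S" and T: "is_op_matrix sX sY V11 V12 V21 V ?T"
    by (intro is_op_matrixI X Y ops)+
  moreover have "inv ?S = ?T"
    using ST TS by (intro inv_equality) auto
  moreover have "invertible_operator (sX \<oplus>\<^sub>s sY) (sX \<oplus>\<^sub>s sY) ?S"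
    using S T ST TS by (intro invertible_operatorI[where g = ?T]) (auto simp: is_op_matrix_def)
  ultimately show "matricially_coupled sX sY U V"
    unfolding matricially_coupled_def by metis
qed

section \<open>Schur coupling as a coupling with invertible corner\<close>

text \<open>A coupling whose corner \<open>U22\<close> is invertible is the same thing as a Schur coupling:
  \<open>D\<close> is the inverse of \<open>U22\<close> and \<open>A\<close> is the Schur complement of \<open>U22\<close>, whose inverse is
  the entry \<open>V11\<close> of the inverse matrix.\<close>

lemma (in coupling) schur_coupled_if_corner_invertible:
  assumes inv: "invertible_operator sY sY U22"
  shows "schur_coupled sX sY U V"
proof -
  define D where "D = inv U22"
  have D: "operator sY sY D" "\<And>y. D (U22 y) = y" "\<And>y. U22 (D y) = y"
    using inv by (auto simp: D_def elim: invertible_operatorE)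
  define A where "A x = U x - U12 (D (U21 x))" for x
  define B where "B y = - U12 (D y)" for y
  define C where "C x = D (U21 x)" for x
  note linD = operator_add[OF D(1)] operator_diff[OF D(1)] operator_minus[OF D(1)]
  have opA: "operator sX sX A" and opB: "operator sY sX B" and opC: "operator sX sY C"
    unfolding A_def B_def C_def
    by (intro operator_intros compose operator_compose[OF D(1)] D ops X Y)+
  have V21: "V21 x = - D (U21 (V11 x))" for x
    using UV(3)[of x] D(2)[of "V21 x"] D(2)[of "- V21 x"]
    by (metis add_eq_0_iff linD(3) minus_minus)
  have V12: "V12 y = - V11 (U12 (D y))" for y
    using VU(2)[of "D y"] by (simp add: D add_eq_0_iff)
  have AV: "A (V11 x) = x" for x
    using UV(1)[of x] by (simp add: A_def V21 linear)
  have VA: "V11 (A x) = x" for x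
    using VU(1)[of x] by (simp add: A_def V12 linear)
  have invA: "inv A = V11"
    using AV VA by (intro inv_equality)
  have invD: "inv D = U22"
    using D by (intro inv_equality)
  have "invertible_operator sX sX A"
    by (rule invertible_operatorI[OF opA ops(5) VA AV])
  moreover have "invertible_operator sY sY D"
    by (rule invertible_operatorI[OF D(1) ops(4) D(3) D(2)])
  moreover have "U = (\<lambda>x. A x - B (inv D (C x)))"
    by (simp add: fun_eq_iff invD A_def B_def C_def D)
  moreover have "V = (\<lambda>y. D y - C (inv A (B y)))"
  proof
    fix y
    show "V y = D y - C (inv A (B y))"
      using VU(4)[of "D y"] by (simp add: invA B_def C_def D V21 linear linD algebra_simps)
  qed
  ultimately show ?thesis
    unfolding schur_coupled_def
    using is_op_matrixI[OF X Y opA opB opC D(1)] by blast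
qed

text \<open>The coupling matrix is \<open>[U, -B D\<^sup>-; D\<^sup>- C, D\<^sup>-]\<close> with inverse \<open>[A\<^sup>-, A\<^sup>- B; -C A\<^sup>-, V]\<close>, where
  \<open>A\<^sup>-\<close> and \<open>D\<^sup>-\<close> are the inverses of \<open>A\<close> and \<open>D\<close>.\<close>

lemma matricially_coupled_if_schur_coupled:
  assumes X: "banach_space sX" and Y: "banach_space sY" and "schur_coupled sX sY U V"
  shows "matricially_coupled sX sY U V"
proof -
  from assms(3) obtain A B C D where ops: "operator sX sX A" "operator sY sX B" "operator sX sY C"
      "operator sY sY D"
    and A: "invertible_operator sX sX A" and D: "invertible_operator sY sY D"
    and U: "U = (\<lambda>x. A x - B (inv D (C x)))" and V: "V = (\<lambda>y. D y - C (inv A (B y)))"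
    unfolding schur_coupled_def is_op_matrix_def by blast
  have invs: "operator sX sX (inv A)" "operator sY sY (inv D)"
    and [simp]: "\<And>x. inv A (A x) = x" "\<And>x. A (inv A x) = x" "\<And>y. inv D (D y) = y" "\<And>y. D (inv D y) = y"
    using A D by (auto elim: invertible_operatorE)
  note all = ops invs
  have "coupling sX sY U (\<lambda>y. - B (inv D y)) (\<lambda>x. inv D (C x)) (inv D)
      (inv A) (\<lambda>y. inv A (B y)) (\<lambda>x. - C (inv A x)) V"
    unfolding U V
    by (intro coupling.intro)
      ((intro operator_intros all[THEN operator_compose] all X Y)+
        | simp add: all[THEN operator_add] all[THEN operator_diff] all[THEN operator_minus])+
  then show ?thesis
    using matricially_coupled_iff[OF X Y] by blast
qed

text \<open>Exchanging the two spaces exchanges \<open>A\<close> with \<open>D\<close> and \<open>B\<close> with \<open>C\<close>.\<close>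

lemma schur_coupled_sym:
  assumes X: "banach_space sX" and Y: "banach_space sY" and "schur_coupled sX sY U V"
  shows "schur_coupled sY sX V U"
proof -
  from assms(3) obtain A B C D where ops: "operator sX sX A" "operator sY sX B" "operator sX sY C"
      "operator sY sY D"
    and "invertible_operator sX sX A" "invertible_operator sY sY D"
    and "U = (\<lambda>x. A x - B (inv D (C x)))" "V = (\<lambda>y. D y - C (inv A (B y)))"
    unfolding schur_coupled_def is_op_matrix_def by blast
  then show ?thesis
    unfolding schur_coupled_def using is_op_matrixI[OF Y X ops(4,3,2,1)] by blast
qed

text \<open>Multiplying the matrix by \<open>[I 0; R I]\<close> on the left and by \<open>[I T; 0 I]\<close> on the right
  changes neither \<open>U\<close> nor \<open>V\<close>, but moves the corner. The problem that remains is therefore to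
  choose \<open>R\<close> and \<open>T\<close> that make the new corner \<open>U22 + R U12 + U21 T + R U T\<close> invertible.\<close>

lemma (in coupling) shift:
  assumes R: "operator sX sY R" and T: "operator sY sX T"
  shows "coupling sX sY U (\<lambda>y. U (T y) + U12 y) (\<lambda>x. R (U x) + U21 x)
    (\<lambda>y. U22 y + R (U12 y) + U21 (T y) + R (U (T y)))
    (\<lambda>x. V11 x - V12 (R x) - T (V21 x) + T (V (R x))) (\<lambda>y. V12 y - T (V y))
    (\<lambda>x. V21 x - V (R x)) V"
proof -
  note all = ops R T
  note lin = all[THEN operator_add] all[THEN operator_diff] all[THEN operator_minus]
     all[THEN operator_zero]
  show ?thesis
    by (intro coupling.intro)
      ((intro operator_intros all[THEN operator_compose] all X Y)+
        | simp add: lin UV' | simp add: lin VU')+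
qed

lemma (in coupling) schur_coupled_if_shifted_corner_invertible:
  assumes "operator sX sY R" and "operator sY sX T"
    and "invertible_operator sY sY (\<lambda>y. U22 y + R (U12 y) + U21 (T y) + R (U (T y)))"
  shows "schur_coupled sX sY U V"
  using coupling.schur_coupled_if_corner_invertible[OF shift[OF assms(1,2)] assms(3)] .

section \<open>Equivalence after extension\<close>

text \<open>With \<open>X\<^sub>0 = Y\<close> and \<open>Y\<^sub>0 = X\<close>, the operator \<open>E\<close> is the coupling matrix with its columns
  exchanged, \<open>[U12 U; U22 U21]\<close>, with inverse \<open>[V21 V; V11 V12]\<close>. Then
  \<open>F\<close> has to satisfy \<open>(V \<oplus> I) F = [V21 V; V11 V12] (U \<oplus> I) = [V21 U V; V11 U V12]\<close>. The relation
  \<open>V21 U = - V U21\<close> exhibits \<open>V\<close> as a left factor of the first row and yields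
  \<open>F = [-U21 I; V11 U V12]\<close>.\<close>

lemma (in coupling) equivalent_after_extension:
  fixes sZ :: "'k \<Rightarrow> 'z::banach \<Rightarrow> 'z"
  assumes Z: "banach_space sZ"
  shows "equivalent_after_extension (sX \<oplus>\<^sub>s sY \<oplus>\<^sub>s sZ) sX sY U V"
proof -
  let ?sW = "sX \<oplus>\<^sub>s sY \<oplus>\<^sub>s sZ"
  note YZ = banach_space_dsum[OF Y Z]
  note W = banach_space_dsum[OF X YZ]
  note XW = banach_space_dsum[OF X W] and YW = banach_space_dsum[OF Y W]
  define X0 where "X0 = {0::'x} \<times> (UNIV :: 'y set) \<times> {0::'z}"
  define Y0 where "Y0 = (UNIV :: 'x set) \<times> {0::'y} \<times> {0::'z}"
  define E where "E = (\<lambda>z::'y \<times> 'x \<times> 'y \<times> 'z.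
    (U12 (fst z) + U (fst (snd z)), (0::'x), U22 (fst z) + U21 (fst (snd z)), (0::'z)))"
  define E' where "E' = (\<lambda>z::'x \<times> 'x \<times> 'y \<times> 'z.
    (V21 (fst z) + V (fst (snd (snd z))), V11 (fst z) + V12 (fst (snd (snd z))), (0::'y), (0::'z)))"
  define F where "F = (\<lambda>z::'x \<times> 'x \<times> 'y \<times> 'z.
    (fst (snd (snd z)) - U21 (fst z), V11 (U (fst z)) + V12 (fst (snd (snd z))), (0::'y), (0::'z)))"
  define F' where "F' = (\<lambda>z::'y \<times> 'x \<times> 'y \<times> 'z.
    (fst (snd z) - V12 (fst z), (0::'x), U22 (V (fst z)) + U21 (fst (snd z)), (0::'z)))"
  have y1: "operator (sX \<oplus>\<^sub>s ?sW) sY (\<lambda>z. fst (snd (snd z)))"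
    by (rule operator_compose[OF operator_fst[OF Y Z] operator_compose[OF operator_snd[OF X YZ] operator_snd[OF X W]]])
  have x1: "operator (sY \<oplus>\<^sub>s ?sW) sX (\<lambda>z. fst (snd z))"
    by (rule operator_compose[OF operator_fst[OF X YZ] operator_snd[OF Y W]])
  note rules = operator_Pair operator_const_zero operator_plus operator_minus_op compose X Y Z YZ W XW YW
    operator_fst x1 y1
  have op: "operator (sY \<oplus>\<^sub>s ?sW) (sX \<oplus>\<^sub>s ?sW) E" "operator (sX \<oplus>\<^sub>s ?sW) (sY \<oplus>\<^sub>s ?sW) E'"
    "operator (sX \<oplus>\<^sub>s ?sW) (sY \<oplus>\<^sub>s ?sW) F" "operator (sY \<oplus>\<^sub>s ?sW) (sX \<oplus>\<^sub>s ?sW) F'"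
    unfolding E_def E'_def F_def F'_def by (intro rules)+
  have EE': "E (E' z) = z" if "z \<in> UNIV \<times> X0" for z
    using that by (auto simp: X0_def E_def E'_def linear UV')
  have E'E: "E' (E z) = z" if "z \<in> UNIV \<times> Y0" for z
    using that by (auto simp: Y0_def E_def E'_def linear VU')
  have FF': "F (F' z) = z" if "z \<in> UNIV \<times> Y0" for z
    using that by (auto simp: Y0_def F_def F'_def linear VU' UV')
  have F'F: "F' (F z) = z" if "z \<in> UNIV \<times> X0" for z
    using that by (auto simp: X0_def F_def F'_def linear VU' UV')
  have sub: "E ` (UNIV \<times> Y0) \<subseteq> UNIV \<times> X0" "E' ` (UNIV \<times> X0) \<subseteq> UNIV \<times> Y0"
    "F ` (UNIV \<times> X0) \<subseteq> UNIV \<times> Y0" "F' ` (UNIV \<times> Y0) \<subseteq> UNIV \<times> X0"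
    by (auto simp: E_def E'_def F_def F'_def X0_def Y0_def)
  have sub_X0: "module.subspace ?sW X0" and sub_Y0: "module.subspace ?sW Y0"
    using X Y Z W YZ
    by (auto simp: module.subspace_def[OF banach_space_module] dsum_apply X0_def Y0_def
        banach_space_zero zero_prod_def)
  have inv_E: "invertible_on (sY \<oplus>\<^sub>s ?sW) (UNIV \<times> Y0) (sX \<oplus>\<^sub>s ?sW) (UNIV \<times> X0) E"
  proof (rule invertible_onI[OF operator_on_subset[OF op(1) sub(1)] operator_on_subset[OF op(2) sub(2)] E'E EE'])
    show "x + y \<in> UNIV \<times> X0" if "x \<in> UNIV \<times> X0" "y \<in> UNIV \<times> X0" for x y
      using that by (auto simp: X0_def)
    show "(sX \<oplus>\<^sub>s ?sW) c x \<in> UNIV \<times> X0" if "x \<in> UNIV \<times> X0" for c x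
      using that by (auto simp: X0_def dsum_apply X Y Z YZ W banach_space_zero)
  qed
  have inv_F: "invertible_on (sX \<oplus>\<^sub>s ?sW) (UNIV \<times> X0) (sY \<oplus>\<^sub>s ?sW) (UNIV \<times> Y0) F"
  proof (rule invertible_onI[OF operator_on_subset[OF op(3) sub(3)] operator_on_subset[OF op(4) sub(4)] F'F FF'])
    show "x + y \<in> UNIV \<times> Y0" if "x \<in> UNIV \<times> Y0" "y \<in> UNIV \<times> Y0" for x y
      using that by (auto simp: Y0_def)
    show "(sY \<oplus>\<^sub>s ?sW) c x \<in> UNIV \<times> Y0" if "x \<in> UNIV \<times> Y0" for c x
      using that by (auto simp: Y0_def dsum_apply X Y Z YZ W banach_space_zero)
  qed
  have eq: "op_matrix U (\<lambda>_. 0) (\<lambda>_. 0) id z = E (op_matrix V (\<lambda>_. 0) (\<lambda>_. 0) id (F z))"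
    if "z \<in> UNIV \<times> X0" for z
    using that by (auto simp: X0_def op_matrix_def E_def F_def linear VU' UV')
  have "closed X0" "closed Y0"
    by (simp_all add: X0_def Y0_def closed_Times)
  then show ?thesis
    unfolding equivalent_after_extension_def using sub_X0 sub_Y0 inv_E inv_F eq by blast
qed

lemma operator_on_mem: "operator_on s S t T f \<Longrightarrow> x \<in> S \<Longrightarrow> f x \<in> T"
  by (auto simp: operator_on_def)

lemma operator_on_minus:
  assumes f: "operator_on s S t T f" and S: "0 \<in> S" "x \<in> S" "- x \<in> S"
  shows "f (- x) = - f x"
proof -
  have add: "f (a + b) = f a + f b" if "a \<in> S" "b \<in> S" for a b
    using f that by (simp add: operator_on_def)
  have "f 0 = 0" using add[of 0 0] S by simp
  then show ?thesis using add[of x "- x"] S by (simp add: eq_neg_iff_add_eq_0 add.commute)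
qed

text \<open>Writing \<open>E\<close>, \<open>F\<close> and their inverses \<open>E'\<close>, \<open>F'\<close> as block matrices, the coupling is
  \<open>[U E11; -F11 F12 E21]\<close> with inverse \<open>[F'12 E'21 -F'11; E'11 V]\<close>. Its equations come from
  comparing entries in \<open>(U \<oplus> I) F' = E (V \<oplus> I)\<close> and \<open>E' (U \<oplus> I) = (V \<oplus> I) F\<close>. The spaces
  \<open>X0\<close> and \<open>Y0\<close> only occur inside the two corners \<open>F12 E21\<close> and \<open>F'12 E'21\<close>, so the coupling
  consists of operators that are defined everywhere.\<close>

lemma matricially_coupled_if_equivalent_after_extension:
  assumes X: "banach_space sX" and Y: "banach_space sY" and W: "banach_space sW"
    and U: "operator sX sX U" and V: "operator sY sY V"
    and "equivalent_after_extension sW sX sY U V"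
  shows "matricially_coupled sX sY U V"
proof -
  from assms(6) obtain X0 Y0 E F where
    subX: "module.subspace sW X0" and subY: "module.subspace sW Y0"
    and E: "invertible_on (sY \<oplus>\<^sub>s sW) (UNIV \<times> Y0) (sX \<oplus>\<^sub>s sW) (UNIV \<times> X0) E"
    and F: "invertible_on (sX \<oplus>\<^sub>s sW) (UNIV \<times> X0) (sY \<oplus>\<^sub>s sW) (UNIV \<times> Y0) F"
    and eq: "\<And>z. z \<in> UNIV \<times> X0 \<Longrightarrow>
        op_matrix U (\<lambda>_. 0) (\<lambda>_. 0) id z = E (op_matrix V (\<lambda>_. 0) (\<lambda>_. 0) id (F z))"
    unfolding equivalent_after_extension_def by blast
  define E' F' where "E' = inv_into (UNIV \<times> Y0) E" and "F' = inv_into (UNIV \<times> X0) F"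
  have op: "operator_on (sY \<oplus>\<^sub>s sW) (UNIV \<times> Y0) (sX \<oplus>\<^sub>s sW) (UNIV \<times> X0) E"
    "operator_on (sX \<oplus>\<^sub>s sW) (UNIV \<times> X0) (sY \<oplus>\<^sub>s sW) (UNIV \<times> Y0) E'"
    "operator_on (sX \<oplus>\<^sub>s sW) (UNIV \<times> X0) (sY \<oplus>\<^sub>s sW) (UNIV \<times> Y0) F"
    "operator_on (sY \<oplus>\<^sub>s sW) (UNIV \<times> Y0) (sX \<oplus>\<^sub>s sW) (UNIV \<times> X0) F'"
    using E F by (simp_all add: invertible_on_def E'_def F'_def)
  have X0: "0 \<in> X0" "\<And>x. x \<in> X0 \<Longrightarrow> - x \<in> X0" and Y0: "0 \<in> Y0" "\<And>x. x \<in> Y0 \<Longrightarrow> - x \<in> Y0"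
    using module.subspace_0[OF banach_space_module] module.subspace_neg[OF banach_space_module] W subX subY
    by blast+
  have EE': "E (E' z) = z" and F'F: "F' (F z) = z" if "z \<in> UNIV \<times> X0" for z
    using E F that bij_betw_inv_into_right bij_betw_inv_into_left
    unfolding invertible_on_def E'_def F'_def by metis+
  have E'E: "E' (E z) = z" and FF': "F (F' z) = z" if "z \<in> UNIV \<times> Y0" for z
    using E F that bij_betw_inv_into_right bij_betw_inv_into_left
    unfolding invertible_on_def E'_def F'_def by metis+
  have split: "f (a, w) = f (a, 0) + f (0, w)"
    if "operator_on (s \<oplus>\<^sub>s sW) (UNIV \<times> T) t T' f" "w \<in> T" "0 \<in> T" for f s t T T' a w
  proof -
    have "f ((a, 0) + (0, w)) = f (a, 0) + f (0, w)"
      using that unfolding operator_on_def by (metis SigmaI UNIV_I)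
    then show ?thesis by simp
  qed
  note splits = split[OF op(1) _ Y0(1)] split[OF op(2) _ X0(1)] split[OF op(3) _ X0(1)] split[OF op(4) _ Y0(1)]
  have snds: "snd (E z) \<in> X0" "snd (F' z) \<in> X0" if "z \<in> UNIV \<times> Y0" for z
    using operator_on_mem[OF op(1) that] operator_on_mem[OF op(4) that] by (auto simp: mem_Times_iff)
  have snds': "snd (E' z) \<in> Y0" "snd (F z) \<in> Y0" if "z \<in> UNIV \<times> X0" for z
    using operator_on_mem[OF op(2) that] operator_on_mem[OF op(3) that] by (auto simp: mem_Times_iff)
  have eqF: "(U (fst z), snd z) = E (V (fst (F z)), snd (F z))" if "z \<in> UNIV \<times> X0" for z
    using eq[OF that] by (simp add: op_matrix_def case_prod_beta)
  have eqE': "E' (U (fst z), snd z) = (V (fst (F z)), snd (F z))" if "z \<in> UNIV \<times> X0" for z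
    using eqF[OF that] E'E snds'(2)[OF that] by simp
  have eqF': "E (V (fst z), snd z) = (U (fst (F' z)), snd (F' z))" if "z \<in> UNIV \<times> Y0" for z
    using eqF[of "F' z"] FF'[OF that] snds(2)[OF that] by (simp add: mem_Times_iff)
  have zero: "E 0 = 0" "E' 0 = 0" "F 0 = 0" "F' 0 = 0" "U 0 = 0" "V 0 = 0"
    using splits[of 0 0] X0 Y0 operator_zero[OF U] operator_zero[OF V] by (auto simp flip: zero_prod_def)
  have neg: "F (0, - w) = - F (0, w)" if "w \<in> X0" for w
    using operator_on_minus[OF op(3), of "(0, w)"] that X0 by (simp add: zero_prod_def)
  have neg': "F' (0, - w) = - F' (0, w)" if "w \<in> Y0" for w
    using operator_on_minus[OF op(4), of "(0, w)"] that Y0 by (simp add: zero_prod_def)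
  note opc = operator_on_compose
  have inl: "operator_on s UNIV (s \<oplus>\<^sub>s sW) (UNIV \<times> T) (\<lambda>y. (y, 0))"
    if "0 \<in> T" "banach_space s" for s :: "'a \<Rightarrow> 'v::banach \<Rightarrow> 'v" and T
    using that W banach_space_zero[OF W]
    by (auto simp: operator_on_def dsum_apply norm_Pair intro!: exI[of _ 1])
  have inr: "operator_on sW T (s \<oplus>\<^sub>s sW) (UNIV \<times> T) (\<lambda>y. (0, y))"
    if "banach_space s" for s :: "'a \<Rightarrow> 'v::banach \<Rightarrow> 'v" and T
    using that W banach_space_zero[OF that]
    by (auto simp: operator_on_def dsum_apply norm_Pair intro!: exI[of _ 1])
  have fst: "operator_on (s \<oplus>\<^sub>s sW) (UNIV \<times> T) s UNIV fst"
    if "banach_space s" for s :: "'a \<Rightarrow> 'v::banach \<Rightarrow> 'v" and T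
    using operator_on_subset[OF operator_fst[OF that W]] by simp
  have snd: "operator_on (s \<oplus>\<^sub>s sW) (UNIV \<times> T) sW T snd"
    if "banach_space s" for s :: "'a \<Rightarrow> 'v::banach \<Rightarrow> 'v" and T
    by (rule operator_on_subset[OF operator_snd[OF that W]]) auto
  have ops: "operator sY sX (\<lambda>y. fst (E (y, 0)))" "operator sX sY (\<lambda>x. fst (F (x, 0)))"
    "operator sX sY (\<lambda>x. fst (E' (x, 0)))" "operator sY sX (\<lambda>y. fst (F' (y, 0)))"
    by (rule opc[OF opc[OF inl op(1)] fst] opc[OF opc[OF inl op(2)] fst] opc[OF opc[OF inl op(3)] fst]
        opc[OF opc[OF inl op(4)] fst] X0 Y0 X Y)+
  have corners: "operator sY sY (\<lambda>y. fst (F (0, snd (E (y, 0)))))"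
    "operator sX sX (\<lambda>x. fst (F' (0, snd (E' (x, 0)))))"
    by (rule opc[OF opc[OF opc[OF opc[OF inl op(1)] snd] opc[OF inr op(3)]] fst]
        opc[OF opc[OF opc[OF opc[OF inl op(2)] snd] opc[OF inr op(4)]] fst] X0 Y0 X Y)+
  have "coupling sX sY U (\<lambda>y. fst (E (y, 0))) (\<lambda>x. - fst (F (x, 0))) (\<lambda>y. fst (F (0, snd (E (y, 0)))))
     (\<lambda>x. fst (F' (0, snd (E' (x, 0))))) (\<lambda>y. - fst (F' (y, 0))) (\<lambda>x. fst (E' (x, 0))) V"
  proof (rule coupling.intro)
    fix x :: 'b and y :: 'c
    define e e' where "e = snd (E (y, 0))" and "e' = snd (E' (x, 0))"
    have e: "e \<in> X0" "e' \<in> Y0"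
      unfolding e_def e'_def using snds(1)[of "(y, 0)"] snds'(1)[of "(x, 0)"] X0 Y0 by auto
    have Ey: "E (y, 0) = (fst (E (y, 0)), e)" and E'x: "E' (x, 0) = (fst (E' (x, 0)), e')"
      by (simp_all add: e_def e'_def)
    have F0: "F (x, 0) = (fst (F (x, 0)), snd (F (x, 0)))" "F' (y, 0) = (fst (F' (y, 0)), snd (F' (y, 0)))"
      by simp_all
    \<comment> \<open>The facts 1, 2, 7, 8 split \<open>E E' = 1\<close>, \<open>E' E = 1\<close>, \<open>F' F = 1\<close>, \<open>F F' = 1\<close> along the direct
      sum; 3 to 6 are the columns of the two intertwining relations.\<close>
    have 1: "E (fst (E' (x, 0)), 0) + E (0, e') = (x, 0)"
      using EE'[of "(x, 0)"] splits(1)[OF e(2), of "fst (E' (x, 0))"] E'x X0 by simp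
    have 2: "E' (fst (E (y, 0)), 0) + E' (0, e) = (y, 0)"
      using E'E[of "(y, 0)"] splits(2)[OF e(1), of "fst (E (y, 0))"] Ey Y0 by simp
    have 3: "E (0, e') = (U (fst (F' (0, e'))), snd (F' (0, e')))"
      using eqF'[of "(0, e')"] e zero by simp
    have 4: "E' (0, e) = (V (fst (F (0, e))), snd (F (0, e)))"
      using eqE'[of "(0, e)"] e zero by simp
    have 5: "E' (U x, 0) = (V (fst (F (x, 0))), snd (F (x, 0)))"
      using eqE'[of "(x, 0)"] X0 by simp
    have 6: "E (V y, 0) = (U (fst (F' (y, 0))), snd (F' (y, 0)))"
      using eqF'[of "(y, 0)"] Y0 by simp
    have 7: "F' (fst (F (x, 0)), 0) + F' (0, snd (F (x, 0))) = (x, 0)"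
      using F'F[of "(x, 0)"] splits(4)[of "snd (F (x, 0))" "fst (F (x, 0))"] snds'(2)[of "(x, 0)"] X0 by simp
    have 8: "F (fst (F' (y, 0)), 0) + F (0, snd (F' (y, 0))) = (y, 0)"
      using FF'[of "(y, 0)"] splits(3)[of "snd (F' (y, 0))" "fst (F' (y, 0))"] snds(2)[of "(y, 0)"] Y0 by simp
    show "U (fst (F' (0, snd (E' (x, 0))))) + fst (E (fst (E' (x, 0)), 0)) = x"
      using arg_cong[OF 1, of fst] 3 by (simp add: e'_def add.commute)
    show "U (- fst (F' (y, 0))) + fst (E (V y, 0)) = 0"
      using 6 by (simp add: operator_minus[OF U])
    show "- fst (F (- fst (F' (y, 0)), 0)) + fst (F (0, snd (E (V y, 0)))) = y"
      using arg_cong[OF 8, of fst] 6 operator_minus[OF ops(2), of "fst (F' (y, 0))"] by simp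
    show "- fst (F (fst (F' (0, snd (E' (x, 0)))), 0)) + fst (F (0, snd (E (fst (E' (x, 0)), 0)))) = 0"
    proof -
      have *: "snd (F' (0, e')) \<in> X0" using snds(2)[of "(0, e')"] e by simp
      have "snd (E (fst (E' (x, 0)), 0)) = - snd (F' (0, e'))"
        using arg_cong[OF 1, of snd] 3 by (simp add: eq_neg_iff_add_eq_0)
      moreover have "F (fst (F' (0, e')), 0) + F (0, snd (F' (0, e'))) = (0, e')"
        using FF'[of "(0, e')"] e splits(3)[OF *, of "fst (F' (0, e'))"] by simp
      then have "fst (F (fst (F' (0, e')), 0)) = - fst (F (0, snd (F' (0, e'))))"
        by (simp add: prod_eq_iff eq_neg_iff_add_eq_0)
      ultimately show ?thesis
        using neg[OF *] by (simp add: e'_def)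
    qed
    show "fst (F' (0, snd (E' (U x, 0)))) + - fst (F' (- fst (F (x, 0)), 0)) = x"
      using arg_cong[OF 7, of fst] 5 operator_minus[OF ops(4), of "fst (F (x, 0))"] by (simp add: add.commute)
    show "fst (F' (0, snd (E' (fst (E (y, 0)), 0)))) + - fst (F' (fst (F (0, snd (E (y, 0)))), 0)) = 0"
    proof -
      have *: "snd (F (0, e)) \<in> Y0" using snds'(2)[of "(0, e)"] e by simp
      have "snd (E' (fst (E (y, 0)), 0)) = - snd (F (0, e))"
        using arg_cong[OF 2, of snd] 4 by (simp add: eq_neg_iff_add_eq_0)
      moreover have "F' (fst (F (0, e)), 0) + F' (0, snd (F (0, e))) = (0, e)"
        using F'F[of "(0, e)"] e splits(4)[OF *, of "fst (F (0, e))"] by simp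
      then have "fst (F' (fst (F (0, e)), 0)) = - fst (F' (0, snd (F (0, e))))"
        by (simp add: prod_eq_iff eq_neg_iff_add_eq_0)
      ultimately show ?thesis
        using neg'[OF *] by (simp add: e_def)
    qed
    show "fst (E' (U x, 0)) + V (- fst (F (x, 0))) = 0"
      using 5 by (simp add: operator_minus[OF V])
    show "fst (E' (fst (E (y, 0)), 0)) + V (fst (F (0, snd (E (y, 0))))) = y"
      using arg_cong[OF 2, of fst] 4 by (simp add: e_def)
  qed (intro X Y U V operator_uminus ops corners)+
  then show ?thesis
    using matricially_coupled_iff[OF X Y] by blast
qed

section \<open>Orthonormal systems and Fourier expansions\<close>

context hilbert_space
begin

lemma banach: "banach_space scale"
  by (rule banach_space_axioms)

lemma additive_ip: "Modules.additive (\<lambda>x. ip x z)"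
  by (simp add: Modules.additive_def ip_add_left)

lemmas ip_zero_left [simp] = Modules.additive.zero [OF additive_ip]
  and ip_diff_left = Modules.additive.diff [OF additive_ip]
  and ip_sum_left = Modules.additive.sum [OF additive_ip]

lemma ip_scaleR_left: "ip (r *\<^sub>R x) z = of_real r * ip x z"
  using ip_scale_left[of "of_real r" x z] by (simp add: scale_of_real)

lemma orthogonal_sym: "ip x y = 0 \<Longrightarrow> ip y x = 0"
  using ip_conj[of y x] by (simp add: sconj_zero)

lemma ip_zero_right [simp]: "ip x 0 = 0"
  by (rule orthogonal_sym) simp

lemma ip_self_eq_0: "ip x x = 0 \<Longrightarrow> x = 0"
  by (simp add: ip_self)

lemma orthogonal_span:
  assumes "\<And>s. s \<in> S \<Longrightarrow> ip s z = 0" and "w \<in> span S"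
  shows "ip w z = 0"
  using assms(2)
proof (induction rule: span_induct)
  case base
  show "subspace {w. ip w z = 0}"
    by (auto simp: subspace_def ip_add_left ip_scale_left)
qed (use assms(1) in auto)

lemma sconj_of_real: "sconj (of_real r :: 'k) = of_real r"
proof (cases "r = 0")
  case False
  have "sconj (of_real r :: 'k) * of_real r = of_real r * of_real r"
    by (simp add: sconj_mult_self scaleR_conv_of_real power2_eq_square)
  with False show ?thesis by simp
qed (simp add: sconj_zero)

text \<open>Expanding in the second argument goes through \<open>ip_conj\<close> and the first argument: by
  orthogonality \<open>ip (x + y) x\<close> is the real number \<open>(norm x)\<^sup>2\<close>, and \<open>sconj\<close> fixes real numbers.\<close>

lemma pythagoras:
  assumes "ip x y = 0"
  shows "(norm (x + y))\<^sup>2 = (norm x)\<^sup>2 + (norm y)\<^sup>2"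
proof -
  have "ip x (x + y) = of_real ((norm x)\<^sup>2)"
    by (subst ip_conj) (simp only: ip_add_left orthogonal_sym[OF assms] ip_self add_0_right sconj_of_real)
  moreover have "ip y (x + y) = of_real ((norm y)\<^sup>2)"
    by (subst ip_conj) (simp only: ip_add_left assms ip_self add_0_left sconj_of_real)
  ultimately have "(of_real ((norm (x + y))\<^sup>2) :: 'k) = of_real ((norm x)\<^sup>2 + (norm y)\<^sup>2)"
    by (simp only: ip_self[symmetric] ip_add_left of_real_add)
  then show ?thesis by (simp only: of_real_eq_iff)
qed

text \<open>Zero vectors are admitted, so that the Gram-Schmidt process needs no case distinction
  on linear dependence.\<close>

definition orthonormal :: "'i set \<Rightarrow> ('i \<Rightarrow> 'v) \<Rightarrow> bool" where
  "orthonormal I e \<longleftrightarrow> (\<forall>i\<in>I. \<forall>j\<in>I. i \<noteq> j \<longrightarrow> ip (e i) (e j) = 0) \<and> (\<forall>i\<in>I. e i = 0 \<or> norm (e i) = 1)"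

definition fourier :: "('i \<Rightarrow> 'v) \<Rightarrow> 'i set \<Rightarrow> 'v \<Rightarrow> 'v" where
  "fourier e I y = (\<Sum>i\<in>I. scale (ip y (e i)) (e i))"

lemma orthonormal_subset: "orthonormal I e \<Longrightarrow> J \<subseteq> I \<Longrightarrow> orthonormal J e"
  unfolding orthonormal_def by blast

lemma norm_orthonormal_sum:
  assumes "finite I" "orthonormal I e"
  shows "(norm (\<Sum>i\<in>I. scale (c i) (e i)))\<^sup>2 = (\<Sum>i\<in>I. (norm (c i))\<^sup>2 * (norm (e i))\<^sup>2)"
  using assms
proof (induction I)
  case (insert i I)
  have "ip (\<Sum>j\<in>I. scale (c j) (e j)) (e i) = 0"
    using insert.hyps insert.prems
    by (auto simp: ip_sum_left ip_scale_left orthonormal_def intro!: sum.neutral)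
  then have "ip (scale (c i) (e i)) (\<Sum>j\<in>I. scale (c j) (e j)) = 0"
    by (simp add: ip_scale_left orthogonal_sym)
  with insert show ?case
    by (simp add: pythagoras norm_scale power_mult_distrib orthonormal_subset[OF _ subset_insertI])
qed simp

lemma fourier_residual_orthogonal:
  assumes "finite I" "orthonormal I e" "i \<in> I"
  shows "ip (y - fourier e I y) (e i) = 0"
proof -
  have "ip (fourier e I y) (e i) = (\<Sum>j\<in>I. if j = i then ip y (e i) else 0)"
    unfolding fourier_def ip_sum_left
  proof (rule sum.cong)
    fix j assume "j \<in> I"
    have "e i = 0 \<or> ip (e i) (e i) = 1"
      using assms by (auto simp: orthonormal_def ip_self)
    then show "ip (scale (ip y (e j)) (e j)) (e i) = (if j = i then ip y (e i) else 0)"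
      using \<open>j \<in> I\<close> assms by (auto simp: orthonormal_def ip_scale_left)
  qed simp
  then show ?thesis
    using assms by (simp add: ip_diff_left)
qed

lemma span_image_mono: "x \<in> span (e ` I) \<Longrightarrow> I \<subseteq> J \<Longrightarrow> x \<in> span (e ` J)"
  using span_mono[OF image_mono] by blast

lemma fourier_in_span: "fourier e I y \<in> span (e ` I)"
  unfolding fourier_def by (intro span_sum span_scale span_base) auto

text \<open>No factors \<open>norm (e i)\<close> appear: where \<open>e i = 0\<close>, the coefficient is zero as well.\<close>

lemma norm_fourier:
  assumes "finite I" "orthonormal I e"
  shows "(norm (fourier e I y))\<^sup>2 = (\<Sum>i\<in>I. (norm (ip y (e i)))\<^sup>2)"
  unfolding fourier_def norm_orthonormal_sum[OF assms]
  using assms by (intro sum.cong) (auto simp: orthonormal_def)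

lemma bessel:
  assumes "finite I" "orthonormal I e"
  shows "norm (fourier e I y) \<le> norm y"
proof -
  have "ip (fourier e I y) (y - fourier e I y) = 0"
    using fourier_residual_orthogonal[OF assms]
    by (intro orthogonal_span[OF _ fourier_in_span]) (auto intro: orthogonal_sym)
  from pythagoras[OF this] have "(norm (fourier e I y))\<^sup>2 \<le> (norm y)\<^sup>2"
    by simp
  then show ?thesis by (rule power2_le_imp_le) simp
qed

lemma fourier_of_span:
  assumes "finite I" "orthonormal I e" "y \<in> span (e ` I)"
  shows "fourier e I y = y"
proof -
  let ?z = "y - fourier e I y"
  have "ip ?z ?z = 0"
    using fourier_residual_orthogonal[OF assms(1,2)]
    by (intro orthogonal_span[OF _ span_diff[OF assms(3) fourier_in_span]])
      (auto intro: orthogonal_sym)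
  then show ?thesis using ip_self_eq_0 by fastforce
qed

lemma operator_ip:
  assumes "e = 0 \<or> norm e = 1"
  shows "operator scale (*) (\<lambda>y. ip y e)"
proof -
  have o: "orthonormal {0::nat} (\<lambda>_. e)"
    using assms by (simp add: orthonormal_def)
  have "norm (ip y e) \<le> norm y * 1" for y
  proof -
    have "(norm (ip y e))\<^sup>2 \<le> (norm y)\<^sup>2"
      using norm_fourier[OF _ o, of y] power_mono[OF bessel[OF _ o, of y], of 2] by simp
    then show ?thesis using power2_le_imp_le[OF _ norm_ge_zero] by simp
  qed
  then show ?thesis
    unfolding operator_on_def using ip_add_left ip_scale_left by blast
qed

lemma operator_fourier:
  assumes "orthonormal I e"
  shows "operator scale scale (fourier e I)"
  unfolding fourier_def
  using assms by (intro operator_intros banach operator_ip) (auto simp: orthonormal_def)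

text \<open>On the span of the first vectors the Fourier sums are eventually the identity, and being
  contractions they converge to the identity on its closure.\<close>

lemma fourier_LIMSEQ:
  assumes e: "orthonormal UNIV e" and y: "y \<in> closure (\<Union>N::nat. span (e ` {..<N}))"
  shows "(\<lambda>N. fourier e {..<N} y) \<longlonglongrightarrow> y"
proof (rule LIMSEQ_I)
  fix r :: real assume "r > 0"
  note oN = orthonormal_subset[OF e, of "{..<_}", simplified]
  obtain w M where w: "w \<in> span (e ` {..<M})" "dist w y < r / 2"
    using y \<open>r > 0\<close> unfolding closure_approachable by (metis UN_E half_gt_zero)
  have "norm (fourier e {..<N} y - y) < r" if "N \<ge> M" for N
  proof -
    have "w \<in> span (e ` {..<N})"
      using w(1) by (rule span_image_mono) (use that in auto)
    then have "fourier e {..<N} w = w"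
      by (intro fourier_of_span oN) simp
    then have "fourier e {..<N} y - y = fourier e {..<N} (y - w) + (w - y)"
      by (simp add: operator_diff[OF operator_fourier[OF oN]])
    also have "norm \<dots> \<le> norm (y - w) + norm (w - y)"
      using bessel[OF _ oN, of N "y - w"] norm_triangle_ineq[of "fourier e {..<N} (y - w)" "w - y"] by simp
    also have "\<dots> < r"
      using w(2) by (simp add: dist_norm norm_minus_commute)
    finally show ?thesis .
  qed
  then show "\<exists>no. \<forall>n\<ge>no. norm (fourier e {..<n} y - y) < r" by blast
qed

fun gram_schmidt :: "(nat \<Rightarrow> 'v) \<Rightarrow> nat \<Rightarrow> 'v" where
  "gram_schmidt d n =
    (let z = d n - (\<Sum>i<n. scale (ip (d n) (gram_schmidt d i)) (gram_schmidt d i))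
     in inverse (norm z) *\<^sub>R z)"

declare gram_schmidt.simps [simp del]

lemma span_scaleR: "x \<in> span S \<Longrightarrow> r *\<^sub>R x \<in> span S"
  using span_scale[of x S "of_real r"] by (simp add: scale_of_real)

lemma gram_schmidt_step:
  defines "r d n \<equiv> d n - fourier (gram_schmidt d) {..<n} (d n)"
  shows "gram_schmidt d n = inverse (norm (r d n)) *\<^sub>R r d n"
  unfolding r_def by (subst gram_schmidt.simps) (simp add: Let_def fourier_def)

lemma orthonormal_gram_schmidt: "orthonormal UNIV (gram_schmidt d)"
proof -
  let ?e = "gram_schmidt d"
  have "orthonormal {..<n} ?e" for n
  proof (induction n)
    case (Suc n)
    have "ip (?e n) (?e i) = 0" if "i < n" for i
      using fourier_residual_orthogonal[OF _ Suc, of i "d n"] that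
      by (simp add: gram_schmidt_step[of d n] ip_scaleR_left)
    moreover from this have "ip (?e i) (?e n) = 0" if "i < n" for i
      using that by (blast intro: orthogonal_sym)
    moreover have "?e n = 0 \<or> norm (?e n) = 1"
      unfolding gram_schmidt_step[of d n]
      by (cases "d n = fourier ?e {..<n} (d n)") auto
    ultimately show ?case
      using Suc by (auto simp: orthonormal_def less_Suc_eq)
  qed (simp add: orthonormal_def)
  then show ?thesis
    unfolding orthonormal_def by (metis UNIV_I lessI lessThan_iff less_Suc_eq linorder_neqE_nat)
qed

lemma gram_schmidt_in_span: "gram_schmidt d n \<in> span (d ` {..n})"
proof (induction n rule: less_induct)
  case (less n)
  have "fourier (gram_schmidt d) {..<n} (d n) \<in> span (d ` {..n})"
    unfolding fourier_def
  proof (intro span_sum span_scale)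
    fix i assume "i \<in> {..<n}"
    then show "gram_schmidt d i \<in> span (d ` {..n})"
      using less[of i] by (auto elim: span_image_mono)
  qed
  then show ?case
    unfolding gram_schmidt_step[of d n] by (intro span_scaleR span_diff) (auto intro: span_base)
qed

lemma in_span_gram_schmidt: "d n \<in> span (gram_schmidt d ` {..n})"
proof -
  let ?e = "gram_schmidt d"
  let ?z = "d n - fourier ?e {..<n} (d n)"
  have "?z = norm ?z *\<^sub>R ?e n"
    unfolding gram_schmidt_step[of d n] by (cases "d n = fourier ?e {..<n} (d n)") auto
  also have "\<dots> \<in> span (?e ` {..n})"
    by (intro span_scaleR span_base) auto
  finally have "?z + fourier ?e {..<n} (d n) \<in> span (?e ` {..n})"
    by (intro span_add span_image_mono[OF fourier_in_span]) auto
  then show ?thesis by simp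
qed

lemma range_in_span_gram_schmidt: "range d \<subseteq> (\<Union>N. span (gram_schmidt d ` {..<N}))"
  using in_span_gram_schmidt[of d] by (force simp flip: lessThan_Suc_atMost)

lemma obtain_orthonormal_basis_of_finite:
  assumes "finite G"
  obtains e and m :: nat where "orthonormal UNIV e" "span (e ` {..<m}) = span G"
proof -
  from assms obtain m :: nat and d where G: "G = d ` {..<m}"
    by (metis finite_imp_nat_seg_image_inj_on lessThan_def)
  have "gram_schmidt d ` {..<m} \<subseteq> span G"
  proof clarsimp
    fix i assume "i < m"
    then show "gram_schmidt d i \<in> span G"
      unfolding G by (intro span_image_mono[OF gram_schmidt_in_span]) auto
  qed
  moreover have "G \<subseteq> span (gram_schmidt d ` {..<m})"
  proof (clarsimp simp: G)
    fix i assume "i < m"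
    then show "d i \<in> span (gram_schmidt d ` {..<m})"
      by (intro span_image_mono[OF in_span_gram_schmidt]) auto
  qed
  ultimately show ?thesis
    using that[OF orthonormal_gram_schmidt[of d], of m] span_minimal[OF _ subspace_span] by blast
qed

text \<open>Dependent choice: at each stage the finitely many vectors chosen so far play the role
  of \<open>S\<close>.\<close>

lemma orthonormal_sequence_choice:
  assumes "\<And>S n. finite S \<Longrightarrow> \<exists>x. norm x = 1 \<and> (\<forall>s\<in>S. ip x s = 0) \<and> R n x"
  obtains f :: "nat \<Rightarrow> 'v" where "orthonormal UNIV f" "\<And>n. norm (f n) = 1" "\<And>n. R n (f n)"
proof -
  define P where "P f n x \<longleftrightarrow> norm x = 1 \<and> (\<forall>i<n. ip x (f i) = 0) \<and> R n x"
    for f :: "nat \<Rightarrow> 'v" and n :: nat and x :: 'v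
  have "\<exists>f. \<forall>n. P f n (f n)"
  proof (rule dependent_wf_choice[OF wf_less_than])
    show "P f n r = P g n r" if "\<And>z. (z, n) \<in> less_than \<Longrightarrow> f z = g z" for f g n r
      using that by (auto simp: P_def)
    show "\<exists>r. P f n r" for n f
      using assms[of "f ` {..<n}" n] by (auto simp: P_def)
  qed
  then obtain f where f: "\<And>n. norm (f n) = 1" "\<And>n i. i < n \<Longrightarrow> ip (f n) (f i) = 0" "\<And>n. R n (f n)"
    unfolding P_def by blast
  have "orthonormal UNIV f"
    using f by (auto simp: orthonormal_def) (metis linorder_neqE_nat orthogonal_sym)
  with f show ?thesis using that by blast
qed

end

text \<open>A linear map that is only prescribed on an orthonormal sequence extends by continuity as
  soon as it is bounded on the finite Fourier sums.\<close>

lemma (in hilbert_space) obtain_operator_from_fourier_sums: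
  fixes t :: "'k \<Rightarrow> 'w::banach \<Rightarrow> 'w" and x :: "nat \<Rightarrow> 'w"
  assumes t: "banach_space t" and e: "orthonormal UNIV e" and "K \<ge> 0"
    and bound: "\<And>y I. finite I \<Longrightarrow> norm (\<Sum>i\<in>I. t (ip y (e i)) (x i)) \<le> K * norm (fourier e I y)"
  obtains T where "operator scale t T" "\<And>y. (\<lambda>n. \<Sum>i<n. t (ip y (e i)) (x i)) \<longlonglongrightarrow> T y"
proof -
  interpret t: banach_space t by (rule t)
  note oI = orthonormal_subset[OF e subset_UNIV]
  have summable: "summable (\<lambda>i. t (ip y (e i)) (x i))" for y
  proof -
    define a where "a i = (norm (ip y (e i)))\<^sup>2" for i
    have "summable a"
    proof (rule summableI_nonneg_bounded)
      show "0 \<le> a i" for i by (simp add: a_def)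
      show "sum a {..<n} \<le> (norm y)\<^sup>2" for n
        using power_mono[OF bessel[OF _ oI, of "{..<n}" y], of 2]
        by (simp add: a_def norm_fourier[OF _ oI])
    qed
    show ?thesis
      unfolding summable_Cauchy
    proof (intro allI impI)
      fix r :: real assume "r > 0"
      define r' where "r' = r / (K + 1)"
      have "r' > 0" using \<open>r > 0\<close> \<open>K \<ge> 0\<close> by (simp add: r'_def)
      with \<open>summable a\<close> obtain N where N: "\<And>m n. m \<ge> N \<Longrightarrow> norm (sum a {m..<n}) < r'\<^sup>2"
        unfolding summable_Cauchy by (metis zero_less_power)
      have "norm (\<Sum>i=m..<n. t (ip y (e i)) (x i)) < r" if "m \<ge> N" for m n
      proof -
        have "(norm (fourier e {m..<n} y))\<^sup>2 < r'\<^sup>2"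
          using N[OF that, of n] by (simp add: norm_fourier[OF _ oI] a_def)
        then have f: "norm (fourier e {m..<n} y) < r'"
          using \<open>r' > 0\<close> by (simp add: power_less_imp_less_base)
        have "norm (\<Sum>i=m..<n. t (ip y (e i)) (x i)) \<le> K * norm (fourier e {m..<n} y)"
          by (rule bound) simp
        also have "\<dots> \<le> K * r'"
          using f \<open>K \<ge> 0\<close> by (intro mult_left_mono) auto
        also have "\<dots> < r"
          using \<open>r > 0\<close> \<open>K \<ge> 0\<close> by (simp add: r'_def field_simps)
        finally show ?thesis .
      qed
      then show "\<exists>N. \<forall>m\<ge>N. \<forall>n. norm (\<Sum>i = m..<n. t (ip y (e i)) (x i)) < r" by blast
    qed
  qed
  define T where "T y = (\<Sum>i. t (ip y (e i)) (x i))" for y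
  have sums: "(\<lambda>i. t (ip y (e i)) (x i)) sums T y" for y
    unfolding T_def using summable by (rule summable_sums)
  then have lim: "(\<lambda>n. \<Sum>i<n. t (ip y (e i)) (x i)) \<longlonglongrightarrow> T y" for y
    by (simp add: sums_def)
  have "operator scale t T"
    unfolding operator_on_def
  proof (intro conjI ballI allI)
    show "T (y + z) = T y + T z" for y z
      using sums_unique2[OF sums[of "y + z"]] sums_add[OF sums[of y] sums[of z]]
      by (simp add: ip_add_left t.scale_left_distrib)
    show "T (scale c y) = t c (T y)" for c y
    proof -
      have "bounded_linear (t c)"
        by (rule bounded_linear_intro[of _ "norm c"])
          (simp_all add: t.scale_right_distrib banach_space_scaleR[OF t] t.norm_scale)
      from bounded_linear.sums[OF this sums[of y]] show ?thesis
        using sums_unique2[OF sums[of "scale c y"]] by (simp add: ip_scale_left)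
    qed
    have "norm (T y) \<le> norm y * K" for y
    proof (rule LIMSEQ_le_const2[OF tendsto_norm[OF lim]])
      have "norm (\<Sum>i<n. t (ip y (e i)) (x i)) \<le> norm y * K" for n
        using bound[of "{..<n}" y] mult_left_mono[OF bessel[OF _ oI, of "{..<n}" y] \<open>K \<ge> 0\<close>]
        by (simp add: mult.commute)
      then show "\<exists>N. \<forall>n\<ge>N. norm (\<Sum>i<n. t (ip y (e i)) (x i)) \<le> norm y * K" by blast
    qed
    then show "\<exists>K. \<forall>y\<in>UNIV. norm (T y) \<le> norm y * K" by blast
  qed auto
  with lim show ?thesis using that by blast
qed

lemma (in separable_hilbert_space) obtain_dense_sequence:
  obtains d :: "nat \<Rightarrow> 'v" where "closure (range d) = UNIV"
proof -
  obtain C :: "'v set" where C: "countable C" "closure C = UNIV"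
    using separable by (auto simp: separable_space_def)
  then have "C \<noteq> {}" by auto
  with C show ?thesis using that[of "from_nat_into C"] range_from_nat_into by metis
qed

text \<open>A left inverse of \<open>A\<close> up to a projection \<open>p\<close> along its kernel. Gram-Schmidt applied to the image
  of a dense sequence gives an orthonormal sequence in the range of \<open>A\<close>; sending its members to
  their preimages in the range of \<open>p\<close>, where \<open>A\<close> is bounded below, defines \<open>R\<close>. On the orthogonal
  complement of the range of \<open>A\<close> this \<open>R\<close> vanishes.\<close>

lemma obtain_partial_inverse:
  fixes sX :: "'k::real_or_complex \<Rightarrow> 'x::banach \<Rightarrow> 'x" and sY :: "'k \<Rightarrow> 'y::banach \<Rightarrow> 'y"
  assumes X: "separable_hilbert_space sX ipX" and Y: "hilbert_space sY ipY"
    and A: "operator sX sY A" and p: "operator sX sX p"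
    and Ap: "\<And>x. A (p x) = A x" and pp: "\<And>x. p (p x) = p x"
    and lower: "\<And>x. norm (p x) \<le> K * norm (A x)"
  obtains R where "operator sY sX R" "\<And>x. R (A x) = p x" "\<And>y. p (R y) = R y"
proof -
  interpret X: separable_hilbert_space sX ipX by (rule X)
  interpret Y: hilbert_space sY ipY by (rule Y)
  note bl = operator_iff_bounded_linear[THEN iffD1, THEN conjunct1]
  have blA: "bounded_linear A" and blp: "bounded_linear p"
    using A p X.banach Y.banach by (auto intro: bl)
  have lower': "norm (p x) \<le> \<bar>K\<bar> * norm (A x)" for x
    by (rule order_trans[OF lower mult_right_mono[OF abs_ge_self norm_ge_zero]])
  obtain d :: "nat \<Rightarrow> 'x" where d: "closure (range d) = UNIV"
    by (rule X.obtain_dense_sequence)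
  define e where "e = Y.gram_schmidt (\<lambda>n. A (d n))"
  have e: "Y.orthonormal UNIV e"
    unfolding e_def by (rule Y.orthonormal_gram_schmidt)
  have sub: "Y.subspace (range A)"
    unfolding Y.subspace_def
    by (auto simp: operator_add[OF A, symmetric] operator_scale[OF A, symmetric])
       (metis operator_zero[OF A] rangeI)
  have "e n \<in> range A" for n
    using Y.gram_schmidt_in_span[of "\<lambda>n. A (d n)" n] Y.span_minimal[OF _ sub, of "(\<lambda>n. A (d n)) ` {..n}"]
    by (auto simp: e_def)
  then have "\<forall>n. \<exists>x. A x = e n" by (metis imageE)
  then obtain x' where x': "\<And>n. A (x' n) = e n" by metis
  define x where "x n = p (x' n)" for n
  have x: "A (x n) = e n" "p (x n) = x n" for n
    by (simp_all add: x_def Ap x' pp)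
  define s where "s I y = (\<Sum>i\<in>I. sX (ipY y (e i)) (x i))" for I y
  have As: "A (s I y) = Y.fourier e I y" and ps: "p (s I y) = s I y" for I y
    by (simp_all add: s_def Y.fourier_def operator_sum[OF A] operator_scale[OF A]
        operator_sum[OF p] operator_scale[OF p] x)
  have "\<bar>K\<bar> \<ge> 0" by simp
  moreover have "norm (s I y) \<le> \<bar>K\<bar> * norm (Y.fourier e I y)" for I y
    using lower'[of "s I y"] by (simp only: ps As)
  ultimately obtain R where R: "operator sY sX R" and lim: "\<And>y. (\<lambda>n. s {..<n} y) \<longlonglongrightarrow> R y"
    using Y.obtain_operator_from_fourier_sums[OF X.banach e, of "\<bar>K\<bar>" x] unfolding s_def by blast
  have "R (A z) = p z" for z
  proof -
    have "A z \<in> closure (\<Union>N. Y.span (e ` {..<N}))"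
    proof -
      have "A z \<in> A ` closure (range d)" by (simp add: d)
      also have "\<dots> \<subseteq> closure (A ` range d)"
        using bounded_linear.continuous_on[OF blA continuous_on_id]
        by (intro image_closure_subset) (auto intro: closure_subset[THEN subsetD])
      also have "A ` range d = range (\<lambda>n. A (d n))" by auto
      also have "closure \<dots> \<subseteq> closure (\<Union>N. Y.span (e ` {..<N}))"
        unfolding e_def by (intro closure_mono Y.range_in_span_gram_schmidt)
      finally show ?thesis .
    qed
    from Y.fourier_LIMSEQ[OF e this]
    have "(\<lambda>N. \<bar>K\<bar> * norm (A z - Y.fourier e {..<N} (A z))) \<longlonglongrightarrow> \<bar>K\<bar> * norm (A z - A z)"
      by (intro tendsto_intros)
    then have null: "(\<lambda>N. \<bar>K\<bar> * norm (A z - Y.fourier e {..<N} (A z))) \<longlonglongrightarrow> 0"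
      by simp
    have "norm (p z - s {..<N} (A z)) \<le> \<bar>K\<bar> * norm (A z - Y.fourier e {..<N} (A z))" for N
      using lower'[of "z - s {..<N} (A z)"]
      by (simp only: operator_diff[OF A] operator_diff[OF p] ps As)
    then have "(\<lambda>N. p z - s {..<N} (A z)) \<longlonglongrightarrow> 0"
      by (rule Lim_null_comparison[OF always_eventually[OF allI] null])
    from tendsto_diff[OF tendsto_const[of "p z"] this]
    have "(\<lambda>N. s {..<N} (A z)) \<longlonglongrightarrow> p z"
      by simp
    with lim[of "A z"] show ?thesis
      by (rule LIMSEQ_unique)
  qed
  moreover have "p (R y) = R y" for y
    using bounded_linear.tendsto[OF blp lim[of y]] lim[of y]
    unfolding ps by (rule LIMSEQ_unique)
  ultimately show ?thesis using that R by blast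
qed

text \<open>For a bounded \<open>U\<close> this says that \<open>U\<close> is bounded below on the closed linear span of the sequence.\<close>

definition (in hilbert_space) bounded_below_on_sequence :: "('v \<Rightarrow> 'w::real_normed_vector) \<Rightarrow> (nat \<Rightarrow> 'v) \<Rightarrow> bool"
  where "bounded_below_on_sequence U f \<longleftrightarrow>
    (\<exists>K. \<forall>c n. norm (\<Sum>i<n. scale (c i) (f i)) \<le> K * norm (U (\<Sum>i<n. scale (c i) (f i))))"

text \<open>A separable Hilbert space, of whatever dimension, embeds isometrically into the closed span of
  any orthonormal sequence: \<open>y\<close> goes to the vector with the same Fourier coefficients.
  An operator that is bounded below on the span therefore is so along the embedding.\<close>

lemma obtain_embedding:
  fixes sX :: "'k::real_or_complex \<Rightarrow> 'x::banach \<Rightarrow> 'x" and sY :: "'k \<Rightarrow> 'y::banach \<Rightarrow> 'y"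
  assumes X: "hilbert_space sX ipX" and Y: "separable_hilbert_space sY ipY"
    and f: "hilbert_space.orthonormal ipX UNIV f" "\<And>n. norm (f n) = 1"
    and t: "banach_space t" and U: "operator sX t U"
    and below: "hilbert_space.bounded_below_on_sequence sX U f"
  obtains T K where "operator sY sX T" "\<And>y. norm y \<le> K * norm (U (T y))"
proof -
  interpret X: hilbert_space sX ipX by (rule X)
  interpret Y: separable_hilbert_space sY ipY by (rule Y)
  obtain K where K: "\<And>c n. norm (\<Sum>i<n. sX (c i) (f i)) \<le> K * norm (U (\<Sum>i<n. sX (c i) (f i)))"
    using below unfolding X.bounded_below_on_sequence_def by blast
  obtain d :: "nat \<Rightarrow> 'y" where d: "closure (range d) = UNIV"
    by (rule Y.obtain_dense_sequence)
  define e where "e = Y.gram_schmidt d"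
  have e: "Y.orthonormal UNIV e"
    unfolding e_def by (rule Y.orthonormal_gram_schmidt)
  define s where "s I y = (\<Sum>i\<in>I. sX (ipY y (e i)) (f i))" for I y
  have norm_s: "norm (s I y) = norm (Y.fourier e I y)" if "finite I" for I y
  proof -
    have "(norm (s I y))\<^sup>2 = (norm (Y.fourier e I y))\<^sup>2"
      using that f(2)
      by (simp add: s_def X.norm_orthonormal_sum X.orthonormal_subset[OF f(1)]
          Y.norm_fourier Y.orthonormal_subset[OF e])
    then show ?thesis by simp
  qed
  then have "norm (s I y) \<le> 1 * norm (Y.fourier e I y)" if "finite I" for I y
    using that by simp
  then obtain T where T: "operator sY sX T" and lim: "\<And>y. (\<lambda>n. s {..<n} y) \<longlonglongrightarrow> T y"
    using Y.obtain_operator_from_fourier_sums[OF X.banach e zero_le_one, of f] unfolding s_def by blast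
  have blU: "bounded_linear U"
    using U X.banach t by (simp add: operator_iff_bounded_linear)
  have "norm y \<le> K * norm (U (T y))" for y
  proof (rule LIMSEQ_le)
    show "(\<lambda>n. K * norm (U (s {..<n} y))) \<longlonglongrightarrow> K * norm (U (T y))"
      by (intro tendsto_intros bounded_linear.tendsto[OF blU] lim)
    have "y \<in> closure (range d)" by (simp add: d)
    also have "\<dots> \<subseteq> closure (\<Union>N. Y.span (e ` {..<N}))"
      unfolding e_def by (intro closure_mono Y.range_in_span_gram_schmidt)
    finally show "(\<lambda>n. norm (Y.fourier e {..<n} y)) \<longlonglongrightarrow> norm y"
      by (intro tendsto_norm Y.fourier_LIMSEQ[OF e])
    have "norm (Y.fourier e {..<n} y) \<le> K * norm (U (s {..<n} y))" for n
      using K[of "\<lambda>i. ipY y (e i)" n] by (simp add: s_def flip: norm_s[of "{..<n}"])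
    then show "\<exists>N. \<forall>n\<ge>N. norm (Y.fourier e {..<n} y) \<le> K * norm (U (s {..<n} y))" by blast
  qed
  with T show ?thesis using that by blast
qed

section \<open>Infinite-dimensional subspaces\<close>

definition (in vector_space) infinite_dim :: "'b set \<Rightarrow> bool" where
  "infinite_dim W \<longleftrightarrow> (\<forall>S. finite S \<longrightarrow> \<not> W \<subseteq> span S)"

text \<open>If the kernel of \<open>\<psi>\<close> in \<open>W\<close> were spanned by finitely many vectors, one vector \<open>w\<close> with
  \<open>\<psi> w \<noteq> 0\<close> would complete them to a spanning set of \<open>W\<close>.\<close>

lemma (in vector_space) infinite_dim_kernels:
  assumes "finite F" and "subspace W" "infinite_dim W"
    and "\<And>\<psi>. \<psi> \<in> F \<Longrightarrow> Vector_Spaces.linear scale (*) \<psi>"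
  shows "subspace {x \<in> W. \<forall>\<psi>\<in>F. \<psi> x = 0} \<and> infinite_dim {x \<in> W. \<forall>\<psi>\<in>F. \<psi> x = 0}"
  using assms(1,4)
proof (induction F)
  case (insert \<psi> F)
  let ?W = "{x \<in> W. \<forall>\<psi>\<in>F. \<psi> x = 0}"
  have W: "subspace ?W" "infinite_dim ?W" using insert by auto
  interpret \<psi>: Vector_Spaces.linear scale "(*)" \<psi> using insert by simp
  have eq: "{x \<in> W. \<forall>\<psi>\<in>insert \<psi> F. \<psi> x = 0} = {x \<in> ?W. \<psi> x = 0}" by auto
  have "infinite_dim {x \<in> ?W. \<psi> x = 0}"
    unfolding infinite_dim_def
  proof (intro allI impI notI)
    fix S assume S: "finite S" "{x \<in> ?W. \<psi> x = 0} \<subseteq> span S"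
    obtain w where w: "w \<in> ?W" "\<psi> w \<noteq> 0"
      using W(2) S unfolding infinite_dim_def by blast
    have "?W \<subseteq> span (insert w S)"
    proof
      fix x assume x: "x \<in> ?W"
      let ?c = "\<psi> x / \<psi> w"
      have "x - scale ?c w \<in> ?W"
        using W(1) x w by (intro subspace_diff subspace_scale)
      moreover have "\<psi> (x - scale ?c w) = 0"
        using w by (simp add: \<psi>.diff \<psi>.scale)
      ultimately have "x - scale ?c w \<in> span S" using S by blast
      then have "(x - scale ?c w) + scale ?c w \<in> span (insert w S)"
        using span_mono[OF subset_insertI, of S w] by (intro span_add span_scale[OF span_base]) auto
      then show "x \<in> span (insert w S)" by simp
    qed
    with W(2) S(1) show False unfolding infinite_dim_def by blast
  qed
  moreover have "subspace {x \<in> ?W. \<psi> x = 0}"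
    using W(1) by (auto simp: subspace_def \<psi>.add \<psi>.scale)
  ultimately show ?case unfolding eq by simp
qed (use assms in simp)

lemma (in hilbert_space) obtain_orthonormal_sequence_in_subspace:
  assumes W: "subspace W" "infinite_dim W"
  obtains f :: "nat \<Rightarrow> 'v" where "orthonormal UNIV f" "\<And>n. norm (f n) = 1" "\<And>n. f n \<in> W"
proof -
  have "\<exists>x. norm x = 1 \<and> (\<forall>s\<in>S. ip x s = 0) \<and> x \<in> W" if "finite S" for S
  proof -
    have lin: "Vector_Spaces.linear scale (*) (\<lambda>x. ip x s)" for s
      by (intro_locales) (auto simp: module_hom_axioms_def ip_add_left ip_scale_left banach_space_module[OF banach_space_field])
    let ?W = "{x \<in> W. \<forall>\<psi>\<in>(\<lambda>s x. ip x s) ` S. \<psi> x = 0}"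
    have sub: "subspace ?W" and inf: "infinite_dim ?W"
      using infinite_dim_kernels[OF _ W, of "(\<lambda>s x. ip x s) ` S"] lin that by auto
    from inf have "\<not> ?W \<subseteq> span {}"
      unfolding infinite_dim_def by blast
    then obtain x where x: "x \<in> ?W" "x \<noteq> 0"
      by auto
    define u where "u = scale (of_real (inverse (norm x))) x"
    have "u \<in> ?W"
      unfolding u_def using x(1) by (rule subspace_scale[OF sub])
    then have "u \<in> W" "\<forall>s\<in>S. ip u s = 0"
      by auto
    moreover have "norm u = 1"
      using x(2) by (simp add: u_def norm_scale norm_inverse)
    ultimately show ?thesis by blast
  qed
  then obtain f :: "nat \<Rightarrow> 'v" where "orthonormal UNIV f" "\<And>n. norm (f n) = 1" "\<And>n. f n \<in> W"
    by (rule orthonormal_sequence_choice[where R = "\<lambda>n x. x \<in> W"]) auto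
  then show ?thesis by (rule that)
qed

section \<open>Removing a finite rank defect\<close>

text \<open>Let \<open>F\<close> be the sum of the \<open>n\<close> rank one operators \<open>\<phi> i \<otimes> a i\<close>. The induction removes one of
  them at a time. If for some \<open>x\<close> the operator \<open>J - \<phi> n \<otimes> (a n - P x)\<close> is invertible, it replaces
  \<open>J\<close>, at the price of adding \<open>\<phi> n \<otimes> x\<close> to \<open>T\<close>. Otherwise \<open>\<psi> = \<phi> n J\<^sup>-\<close> (\<open>J\<^sup>-\<close> the inverse of \<open>J\<close>)
  vanishes on the range of \<open>P\<close> and \<open>\<psi> (a n) = 1\<close>. Evaluating \<open>\<psi>\<close> on a solution of
  \<open>a n = P x + (J - F) z\<close> then shows that \<open>\<psi> (a i) \<noteq> 0\<close> for some \<open>i < n\<close>. In the rewritten sum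
  \<open>\<phi> n \<otimes> (a n - a i) + (\<phi> i + \<phi> n) \<otimes> a i + \<dots>\<close> the first term can be absorbed into \<open>J\<close>.\<close>

lemma obtain_invertible_completion:
  fixes sX :: "'k::real_or_complex \<Rightarrow> 'x::banach \<Rightarrow> 'x" and sY :: "'k \<Rightarrow> 'y::banach \<Rightarrow> 'y"
    and a :: "nat \<Rightarrow> 'y" and \<phi> :: "nat \<Rightarrow> 'y \<Rightarrow> 'k"
  assumes X: "banach_space sX" and Y: "banach_space sY"
    and P: "operator sX sY P" and J: "invertible_operator sY sY J"
    and \<phi>: "\<And>i. i < n \<Longrightarrow> operator sY (*) (\<phi> i)"
    and onto: "\<And>y. \<exists>x z. y = P x + (J z - (\<Sum>i<n. sY (\<phi> i z) (a i)))"
  shows "\<exists>T. operator sY sX T \<and>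
    invertible_operator sY sY (\<lambda>y. J y - (\<Sum>i<n. sY (\<phi> i y) (a i)) + P (T y))"
  using J \<phi> onto
proof (induction n arbitrary: J \<phi> a)
  case 0
  have "operator sY sX (\<lambda>y. 0)"
    by (rule operator_const_zero[OF Y X])
  moreover have "invertible_operator sY sY (\<lambda>y. J y - (\<Sum>i<0. sY (\<phi> i y) (a i)) + P 0)"
    using 0 by (simp add: operator_zero[OF P])
  ultimately show ?case by blast
next
  case (Suc n)
  interpret X: banach_space sX by (rule X)
  interpret Y: banach_space sY by (rule Y)
  from Suc.prems(1) have Jop: "operator sY sY J" "operator sY sY (inv J)"
    and inv: "\<And>x. inv J (J x) = x" "\<And>x. J (inv J x) = x"
    by (auto elim: invertible_operatorE)
  note \<phi>n = Suc.prems(2)[OF lessI]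
  note linJ = operator_diff[OF Jop(2)] operator_sum[OF Jop(2)] operator_scale[OF Jop(2)]
  note lin\<phi> = operator_diff[OF \<phi>n] operator_sum[OF \<phi>n] operator_scale[OF \<phi>n]
  show ?case
  proof (cases "\<exists>x. \<phi> n (inv J (a n - P x)) \<noteq> 1")
    case True
    then obtain x where x: "\<phi> n (inv J (a n - P x)) \<noteq> 1" by blast
    define J' where "J' y = J y - sY (\<phi> n y) (a n - P x)" for y
    have J': "invertible_operator sY sY J'"
      using invertible_rank_one_perturbation[OF Y Suc.prems(1) \<phi>n x] by (simp add: J'_def[abs_def])
    have eq: "J' z - (\<Sum>i<n. sY (\<phi> i z) (a i))
        = J z - (\<Sum>i<Suc n. sY (\<phi> i z) (a i)) + P (sX (\<phi> n z) x)" for z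
      by (simp add: J'_def operator_scale[OF P] Y.scale_right_diff_distrib)
    have "\<exists>x z. y = P x + (J' z - (\<Sum>i<n. sY (\<phi> i z) (a i)))" for y
    proof -
      obtain x' z where "y = P x' + (J z - (\<Sum>i<Suc n. sY (\<phi> i z) (a i)))"
        using Suc.prems(3) by blast
      then have "y = P (x' - sX (\<phi> n z) x) + (J' z - (\<Sum>i<n. sY (\<phi> i z) (a i)))"
        unfolding eq by (simp add: operator_diff[OF P])
      then show ?thesis by blast
    qed
    with Suc.IH[where \<phi> = \<phi> and a = a, OF J'] Suc.prems(2) obtain T where T: "operator sY sX T"
      and inv_T: "invertible_operator sY sY (\<lambda>y. J' y - (\<Sum>i<n. sY (\<phi> i y) (a i)) + P (T y))"
      by (meson less_SucI)
    have "operator sY sX (\<lambda>y. sX (\<phi> n y) x + T y)"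
      by (intro operator_plus[OF Y X] operator_rank_one[OF Y X] \<phi>n T)
    moreover have "J' y - (\<Sum>i<n. sY (\<phi> i y) (a i)) + P (T y)
        = J y - (\<Sum>i<Suc n. sY (\<phi> i y) (a i)) + P (sX (\<phi> n y) x + T y)" for y
      unfolding eq by (simp add: operator_add[OF P])
    with inv_T have "invertible_operator sY sY
        (\<lambda>y. J y - (\<Sum>i<Suc n. sY (\<phi> i y) (a i)) + P (sX (\<phi> n y) x + T y))"
      by (simp only:)
    ultimately show ?thesis by blast
  next
    case False
    let ?\<psi> = "\<lambda>y. \<phi> n (inv J y)"
    have \<psi>a: "?\<psi> (a n) = 1"
      using False operator_zero[OF P] by (metis diff_zero)
    have \<psi>P: "?\<psi> (P x) = 0" for x
      using False \<psi>a by (simp add: linJ lin\<phi>)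
    have "\<exists>i<n. ?\<psi> (a i) \<noteq> 0"
    proof (rule ccontr)
      assume zero: "\<not> (\<exists>i<n. ?\<psi> (a i) \<noteq> 0)"
      obtain x z where "a n = P x + (J z - (\<Sum>i<Suc n. sY (\<phi> i z) (a i)))"
        using Suc.prems(3) by blast
      then have "?\<psi> (a n) = ?\<psi> (P x + (J z - (\<Sum>i<Suc n. sY (\<phi> i z) (a i))))"
        by (rule arg_cong)
      also have "\<dots> = ?\<psi> (P x) + (?\<psi> (J z) - (\<Sum>i<Suc n. \<phi> i z * ?\<psi> (a i)))"
        by (simp add: operator_add[OF Jop(2)] operator_add[OF \<phi>n] linJ lin\<phi>)
      also have "\<dots> = 0"
        using zero by (simp add: \<psi>a \<psi>P inv)
      finally show False
        by (simp add: \<psi>a)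
    qed
    then obtain i where i: "i < n" "?\<psi> (a i) \<noteq> 0" by blast
    define J' where "J' y = J y - sY (\<phi> n y) (a n - a i)" for y
    have "?\<psi> (a n - a i) \<noteq> 1"
      using i by (simp add: linJ lin\<phi> \<psi>a)
    then have J': "invertible_operator sY sY J'"
      using invertible_rank_one_perturbation[OF Y Suc.prems(1) \<phi>n] by (simp add: J'_def[abs_def])
    define \<phi>' where "\<phi>' j = (if j = i then (\<lambda>y. \<phi> i y + \<phi> n y) else \<phi> j)" for j
    have \<phi>': "operator sY (*) (\<phi>' j)" if "j < n" for j
      using that i Suc.prems(2) by (auto simp: \<phi>'_def intro!: operator_plus[OF Y banach_space_field])
    have "(\<Sum>j<n. sY (\<phi>' j y) (a j)) = (\<Sum>j<n. sY (\<phi> j y) (a j) + (if j = i then sY (\<phi> n y) (a i) else 0))" for y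
      by (intro sum.cong) (auto simp: \<phi>'_def Y.scale_left_distrib)
    then have "(\<Sum>j<n. sY (\<phi>' j y) (a j)) = (\<Sum>j<n. sY (\<phi> j y) (a j)) + sY (\<phi> n y) (a i)" for y
      using i by (simp add: sum.distrib)
    then have eq: "J' y - (\<Sum>j<n. sY (\<phi>' j y) (a j)) = J y - (\<Sum>j<Suc n. sY (\<phi> j y) (a j))" for y
      by (simp add: J'_def Y.scale_right_diff_distrib)
    show ?thesis
      using Suc.IH[where \<phi> = \<phi>' and a = a, OF J' \<phi>', unfolded eq, OF _ Suc.prems(3)] .
  qed
qed

section \<open>Operators bounded below on no orthonormal sequence\<close>

text \<open>If \<open>P\<close> were not bounded below on any subspace of finite codimension, it would be
  tiny on some orthonormal sequence, where the identity would then be nearly \<open>V11 U\<close>.\<close>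

lemma bounded_below_off_finite_set:
  fixes sX :: "'k::real_or_complex \<Rightarrow> 'x::banach \<Rightarrow> 'x"
  assumes X: "hilbert_space sX ipX" and Y: "banach_space sY"
    and U: "operator sX t U" and P: "operator sX sY P"
    and V11: "operator t sX V11" and V12: "operator sY sX V12"
    and id: "\<And>x. V11 (U x) + V12 (P x) = x"
    and no: "\<And>f. hilbert_space.orthonormal ipX UNIV f \<Longrightarrow> (\<And>n. norm (f n) = 1) \<Longrightarrow>
        \<not> hilbert_space.bounded_below_on_sequence sX U f"
  obtains G K where "finite G" "\<And>x. (\<And>g. g \<in> G \<Longrightarrow> ipX x g = 0) \<Longrightarrow> norm x \<le> K * norm (P x)"
proof (rule ccontr)
  interpret X: hilbert_space sX ipX by (rule X)
  interpret Y: banach_space sY by (rule Y)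
  assume "\<not> thesis"
  with that have neg: "\<exists>x. (\<forall>g\<in>G. ipX x g = 0) \<and> norm x > K * norm (P x)" if "finite G" for G K
    using that by (metis not_le)
  obtain L where L: "L > 0" "\<And>y. norm (V12 y) \<le> L * norm y"
    using operator_bound[OF V12] by blast
  obtain M where M: "M > 0" "\<And>y. norm (V11 y) \<le> M * norm y"
    using operator_bound[OF V11] by blast
  \<comment> \<open>The norms of \<open>P (f n)\<close> will sum up to at most \<open>2 \<epsilon>\<close>, which makes \<open>V12 P\<close> at most \<open>1/2\<close>.\<close>
  define \<epsilon> where "\<epsilon> = 1 / (4 * L)"
  have \<epsilon>: "\<epsilon> > 0" using L by (simp add: \<epsilon>_def)
  have "\<exists>x. norm x = 1 \<and> (\<forall>s\<in>S. ipX x s = 0) \<and> norm (P x) \<le> \<epsilon> * (1/2)^n" if "finite S" for S n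
  proof -
    define K where "K = 2^n / \<epsilon>"
    obtain x where x: "\<forall>s\<in>S. ipX x s = 0" "norm x > K * norm (P x)"
      using neg[OF \<open>finite S\<close>] by blast
    have nx: "norm x > 0"
      using x(2) \<epsilon> by (metis K_def divide_nonneg_pos mult_nonneg_nonneg norm_ge_zero not_less
          order_less_le_trans zero_le_numeral zero_le_power)
    let ?u = "inverse (norm x) *\<^sub>R x"
    have "P ?u = inverse (norm x) *\<^sub>R P x"
      by (rule operator_scaleR_commute[OF P X.banach Y])
    then have "norm (P ?u) \<le> \<epsilon> * (1/2)^n"
      using x(2) nx \<epsilon> by (simp add: K_def field_simps)
    moreover have "norm ?u = 1" "\<forall>s\<in>S. ipX ?u s = 0"
      using nx x(1) by (auto simp: X.ip_scaleR_left)
    ultimately show ?thesis by blast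
  qed
  then obtain f where f: "X.orthonormal UNIV f" "\<And>n. norm (f n) = 1"
    and small: "\<And>n. norm (P (f n)) \<le> \<epsilon> * (1/2)^n"
    using X.orthonormal_sequence_choice[where R = "\<lambda>n x. norm (P x) \<le> \<epsilon> * (1/2)^n"] by blast
  have "norm (\<Sum>i<n. sX (c i) (f i)) \<le> 2 * M * norm (U (\<Sum>i<n. sX (c i) (f i)))" for c n
  proof -
    define s where "s = (\<Sum>i<n. sX (c i) (f i))"
    have c: "norm (c i) \<le> norm s" if "i < n" for i
    proof (rule power2_le_imp_le)
      have "(norm (c i))\<^sup>2 \<le> (\<Sum>i<n. (norm (c i))\<^sup>2)"
        using that by (intro member_le_sum) auto
      also have "\<dots> = (norm s)\<^sup>2"
        by (simp add: s_def X.norm_orthonormal_sum X.orthonormal_subset[OF f(1)] f(2))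
      finally show "(norm (c i))\<^sup>2 \<le> (norm s)\<^sup>2" .
    qed simp
    have "norm (P s) \<le> (\<Sum>i<n. norm (c i) * norm (P (f i)))"
      unfolding s_def operator_sum[OF P] operator_scale[OF P]
      by (rule order_trans[OF norm_sum]) (simp add: Y.norm_scale)
    also have "\<dots> \<le> (\<Sum>i<n. norm s * (\<epsilon> * (1/2)^i))"
      by (intro sum_mono mult_mono c small) auto
    also have "\<dots> = norm s * \<epsilon> * (\<Sum>i<n. (1/2)^i)"
      by (simp add: sum_distrib_left mult.assoc)
    also have "\<dots> \<le> norm s * \<epsilon> * 2"
    proof (intro mult_left_mono)
      have "(\<Sum>i<n. (1/2)^i) = 2 - 2 * (1/2::real)^n"
        by (induction n) auto
      then show "(\<Sum>i<n. (1/2)^i) \<le> (2::real)"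
        by simp
    qed (use \<epsilon> in simp)
    finally have Ps: "L * norm (P s) \<le> norm s / 2"
      using L by (simp add: \<epsilon>_def field_simps)
    have "norm s \<le> norm (V11 (U s)) + norm (V12 (P s))"
      using norm_triangle_ineq[of "V11 (U s)" "V12 (P s)"] by (simp add: id)
    also have "\<dots> \<le> M * norm (U s) + norm s / 2"
      using M(2)[of "U s"] L(2)[of "P s"] Ps by linarith
    finally show ?thesis by (simp add: s_def)
  qed
  then have "X.bounded_below_on_sequence U f"
    unfolding X.bounded_below_on_sequence_def by blast
  with no f show False by blast
qed

text \<open>An infinite-dimensional range of \<open>\<rho>\<close> would contain an orthonormal sequence that satisfies the
  finitely many conditions \<open>F\<close>, and \<open>V\<close> would be bounded below on it.\<close>

lemma (in hilbert_space) obtain_finite_rank_representation: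
  assumes \<rho>: "operator scale scale \<rho>" and idem: "\<And>y. \<rho> (\<rho> y) = \<rho> y"
    and F: "finite F" "\<And>\<psi>. \<psi> \<in> F \<Longrightarrow> Vector_Spaces.linear scale (*) \<psi>"
    and below: "\<And>y. \<rho> y = y \<Longrightarrow> (\<And>\<psi>. \<psi> \<in> F \<Longrightarrow> \<psi> y = 0) \<Longrightarrow> norm y \<le> K * norm (V y)"
    and no: "\<And>f. orthonormal UNIV f \<Longrightarrow> (\<And>n. norm (f n) = 1) \<Longrightarrow> \<not> bounded_below_on_sequence V f"
  obtains n :: nat and \<phi> a where "\<And>i. operator scale (*) (\<phi> i)" "\<And>y. \<rho> y = (\<Sum>i<n. scale (\<phi> i y) (a i))"
proof -
  let ?W = "{y. \<rho> y = y}" and ?W' = "{y \<in> {y. \<rho> y = y}. \<forall>\<psi>\<in>F. \<psi> y = 0}"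
  have sub: "subspace ?W"
    by (auto simp: subspace_def operator_zero[OF \<rho>] operator_add[OF \<rho>] operator_scale[OF \<rho>])
  have "\<not> infinite_dim ?W"
  proof
    assume "infinite_dim ?W"
    then have W': "subspace ?W'" "infinite_dim ?W'"
      using infinite_dim_kernels[OF F(1) sub _ F(2)] by blast+
    obtain f :: "nat \<Rightarrow> 'v" where f: "orthonormal UNIV f" "\<And>n. norm (f n) = 1" "\<And>n. f n \<in> ?W'"
      using obtain_orthonormal_sequence_in_subspace[OF W'] by blast
    have "(\<Sum>i<n. scale (c i) (f i)) \<in> ?W'" for c n
      by (intro subspace_sum[OF W'(1)] subspace_scale[OF W'(1)] f)
    then have "norm (\<Sum>i<n. scale (c i) (f i)) \<le> K * norm (V (\<Sum>i<n. scale (c i) (f i)))" for c n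
      by (intro below) auto
    then have "bounded_below_on_sequence V f"
      unfolding bounded_below_on_sequence_def by blast
    with no[OF f(1,2)] show False by blast
  qed
  then obtain S where S: "finite S" "?W \<subseteq> span S"
    unfolding infinite_dim_def by blast
  obtain e and m :: nat where e: "orthonormal UNIV e" "span (e ` {..<m}) = span S"
    by (rule obtain_orthonormal_basis_of_finite[OF S(1)])
  have "\<rho> y = (\<Sum>i<m. scale (ip (\<rho> y) (e i)) (e i))" for y
  proof -
    have "\<rho> y \<in> span (e ` {..<m})"
      using S(2) idem unfolding e(2) by blast
    from fourier_of_span[OF _ orthonormal_subset[OF e(1)] this] show ?thesis
      by (simp add: fourier_def)
  qed
  moreover have "operator scale (*) (\<lambda>y. ip (\<rho> y) (e i))" for i
    using e(1) by (intro operator_compose[OF operator_ip \<rho>]) (auto simp: orthonormal_def)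
  ultimately show ?thesis by (rule that[rotated])
qed

section \<open>From matricial coupling to Schur coupling\<close>

text \<open>Choose \<open>T\<close> with \<open>U T\<close> bounded below and a left inverse \<open>R\<close> of \<open>U T\<close>. The shift by \<open>r R\<close> and
  \<open>r T\<close> turns the corner into \<open>r\<^sup>2 + r (R U12 + U21 T) + U22\<close>, where the quadratic term wins for
  large \<open>r\<close>.\<close>

lemma (in coupling) schur_coupled_if_bounded_below:
  assumes hX: "hilbert_space sX ipX" and hY: "separable_hilbert_space sY ipY"
    and f: "hilbert_space.orthonormal ipX UNIV f" "\<And>n. norm (f n) = 1"
      "hilbert_space.bounded_below_on_sequence sX U f"
  shows "schur_coupled sX sY U V"
proof -
  obtain T K where T: "operator sY sX T" and K: "\<And>y. norm y \<le> K * norm (U (T y))"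
    using obtain_embedding[OF hX hY f(1,2) X ops(1) f(3)] by blast
  have UT: "operator sY sX (\<lambda>y. U (T y))"
    by (intro compose T)
  obtain R where R: "operator sX sY R" "\<And>y. R (U (T y)) = y"
    using obtain_partial_inverse[OF hY hX UT operator_id[OF Y]] K by blast
  define L where "L y = R (U12 y) + U21 (T y)" for y
  have L: "operator sY sY L"
    unfolding L_def by (intro operator_plus[OF Y Y] operator_compose[OF R(1)] ops compose T)
  obtain M where M: "M > 0" "\<And>y. norm (L y) \<le> M * norm y"
    using operator_bound[OF L] by blast
  obtain N where N: "N > 0" "\<And>y. norm (U22 y) \<le> N * norm y"
    using operator_bound[OF ops(4)] by blast
  \<comment> \<open>large enough that \<open>r M + N < r\<^sup>2\<close>\<close>
  define r where "r = 1 + M + N"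
  have r: "r > 0" using M N by (simp add: r_def)
  have "invertible_operator sY sY (\<lambda>y. r\<^sup>2 *\<^sub>R y + (r *\<^sub>R L y + U22 y))"
  proof (rule invertible_scaleR_plus[OF Y])
    show "operator sY sY (\<lambda>y. r *\<^sub>R L y + U22 y)"
      by (intro operator_plus[OF Y Y] operator_scaleR[OF Y Y] L ops)
    show "norm (r *\<^sub>R L y + U22 y) \<le> (r * M + N) * norm y" for y
    proof -
      have "norm (r *\<^sub>R L y + U22 y) \<le> r * norm (L y) + norm (U22 y)"
        using norm_triangle_ineq[of "r *\<^sub>R L y" "U22 y"] r by simp
      also have "\<dots> \<le> r * (M * norm y) + N * norm y"
        using M N r by (intro add_mono mult_left_mono) auto
      finally show ?thesis by (simp add: algebra_simps)
    qed
    show "r * M + N < r\<^sup>2" "0 \<le> r * M + N"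
      using M(1) N(1) mult_pos_pos[OF M(1) N(1)] mult_pos_pos[OF N(1) N(1)] mult_pos_pos[OF M(1) M(1)]
      by (auto simp: r_def power2_eq_square algebra_simps intro!: add_pos_pos add_nonneg_nonneg)
  qed
  moreover have "U22 y + r *\<^sub>R R (U12 y) + U21 (r *\<^sub>R T y) + r *\<^sub>R R (U (r *\<^sub>R T y))
      = r\<^sup>2 *\<^sub>R y + (r *\<^sub>R L y + U22 y)" for y
  proof -
    note sc = operator_scaleR_commute[OF ops(1) X X] operator_scaleR_commute[OF ops(3) X Y]
      operator_scaleR_commute[OF R(1) X Y]
    show ?thesis
      by (simp add: sc L_def R(2) power2_eq_square algebra_simps)
  qed
  ultimately have "invertible_operator sY sY (\<lambda>y. U22 y + r *\<^sub>R R (U12 y) + U21 (r *\<^sub>R T y) + r *\<^sub>R R (U (r *\<^sub>R T y)))"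
    by (simp only:)
  then show ?thesis
    by (rule schur_coupled_if_shifted_corner_invertible[OF operator_scaleR[OF X Y R(1)] operator_scaleR[OF Y X T]])
qed

text \<open>Here \<open>U21\<close> is a Fredholm operator. It is bounded below off a finite set, so its restriction
  to the range of a projection \<open>p\<close> of finite corank has a left inverse \<open>R\<close>. The complementary
  projection \<open>\<rho> = 1 - U21 R\<close> has finite rank: \<open>\<rho> = \<rho> U21 V12 + \<rho> U22 V\<close>, and the first summand
  vanishes where \<open>(1 - p) V12 y = 0\<close>, which is a finite number of linear conditions on \<open>y\<close>; were the
  rank infinite, \<open>V\<close> would be bounded below on an infinite-dimensional subspace. Shifting the corner by \<open>T = r R\<close>
  gives \<open>U22 + r (1 - \<rho>)\<close>, for large \<open>r\<close> an invertible operator minus one of finite rank; the finite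
  rank defect is removed by a further shift.

  Whatever the index of \<open>U21\<close>, the operator \<open>U21 R = 1 - \<rho>\<close> has index zero; this is why the
  remaining obstruction is only a finite rank one.\<close>

lemma (in coupling) schur_coupled_if_not_bounded_below:
  assumes sX: "separable_hilbert_space sX ipX" and hY: "hilbert_space sY ipY"
    and noU: "\<And>f. hilbert_space.orthonormal ipX UNIV f \<Longrightarrow> (\<And>n. norm (f n) = 1) \<Longrightarrow>
        \<not> hilbert_space.bounded_below_on_sequence sX U f"
    and noV: "\<And>f. hilbert_space.orthonormal ipY UNIV f \<Longrightarrow> (\<And>n. norm (f n) = 1) \<Longrightarrow>
        \<not> hilbert_space.bounded_below_on_sequence sY V f"
  shows "schur_coupled sX sY U V"
proof -
  interpret X: separable_hilbert_space sX ipX by (rule sX)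
  interpret Y: hilbert_space sY ipY by (rule hY)
  obtain G K where G: "finite G"
    and K: "\<And>x. (\<And>g. g \<in> G \<Longrightarrow> ipX x g = 0) \<Longrightarrow> norm x \<le> K * norm (U21 x)"
    using bounded_below_off_finite_set[OF X.hilbert_space_axioms Y ops(1,3,5,6) VU(1) noU] by blast
  obtain e and m :: nat where e: "X.orthonormal UNIV e" "X.span (e ` {..<m}) = X.span G"
    by (rule X.obtain_orthonormal_basis_of_finite[OF G])
  note e' = X.orthonormal_subset[OF e(1) subset_UNIV]
  define q where "q = X.fourier e {..<m}"
  have q: "operator sX sX q"
    unfolding q_def by (rule X.operator_fourier[OF e'])
  define p where "p x = x - q x" for x
  have p: "operator sX sX p"
    unfolding p_def by (intro operator_minus_op[OF X X] operator_id X q)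
  have p_orth: "ipX (p x) g = 0" if "g \<in> G" for x g
  proof -
    have "ipX g (p x) = 0"
    proof (rule X.orthogonal_span)
      show "g \<in> X.span (e ` {..<m})" using that X.span_base e(2) by blast
      show "ipX s (p x) = 0" if "s \<in> e ` {..<m}" for s
        using that X.fourier_residual_orthogonal[OF _ e', of "{..<m}" _ x]
        by (auto simp: p_def q_def intro: X.orthogonal_sym)
    qed
    then show ?thesis by (rule X.orthogonal_sym)
  qed
  have qq: "q (q x) = q x" for x
    unfolding q_def by (intro X.fourier_of_span e' X.fourier_in_span) simp
  have pp: "p (p x) = p x" for x
    by (simp add: p_def operator_diff[OF q] qq)
  define A where "A x = U21 (p x)" for x
  have A: "operator sX sY A"
    unfolding A_def by (intro compose p)
  have "norm (p x) \<le> K * norm (A x)" for x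
    unfolding A_def by (intro K p_orth)
  then obtain R where R: "operator sY sX R" "\<And>x. R (A x) = p x" "\<And>y. p (R y) = R y"
    using obtain_partial_inverse[OF sX hY A p, of K] pp by (auto simp: A_def)
  have AR: "A (R y) = U21 (R y)" for y
    by (simp add: A_def R(3))
  have Ap: "A (p x) = A x" for x
    by (simp add: A_def pp)
  define \<rho> where "\<rho> y = y - U21 (R y)" for y
  have \<rho>: "operator sY sY \<rho>"
    unfolding \<rho>_def by (intro operator_minus_op[OF Y Y] operator_id Y compose R)
  have \<rho>A: "\<rho> (A x) = 0" for x
    by (simp add: \<rho>_def R(2) flip: A_def)
  have \<rho>\<rho>: "\<rho> (\<rho> y) = \<rho> y" for y
  proof -
    have "\<rho> (\<rho> y) = \<rho> y - \<rho> (A (R y))"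
      using operator_diff[OF \<rho>, of y "A (R y)"] by (simp add: \<rho>_def AR)
    then show ?thesis by (simp add: \<rho>A)
  qed
  obtain M where M: "M > 0" "\<And>y. norm (\<rho> (U22 y)) \<le> M * norm y"
    using operator_bound[OF operator_compose[OF \<rho> ops(4)]] by blast
  \<comment> \<open>The common kernel of \<open>F\<close> consists of the \<open>y\<close> with \<open>q (V12 y) = 0\<close>.\<close>
  define F where "F = (\<lambda>i y. ipX (V12 y) (e i)) ` {..<m}"
  have below: "norm y \<le> M * norm (V y)" if "\<rho> y = y" "\<And>\<psi>. \<psi> \<in> F \<Longrightarrow> \<psi> y = 0" for y
  proof -
    have "ipX (V12 y) (e i) = 0" if "i < m" for i
      using \<open>\<And>\<psi>. \<psi> \<in> F \<Longrightarrow> \<psi> y = 0\<close>[of "\<lambda>y. ipX (V12 y) (e i)"] that by (simp add: F_def)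
    then have "q (V12 y) = 0"
      by (simp add: q_def X.fourier_def)
    then have "\<rho> (U21 (V12 y)) = 0"
      using \<rho>A[of "V12 y"] by (simp add: A_def p_def)
    then have "y = \<rho> (U22 (V y))"
      using UV(4)[of y] that(1) operator_add[OF \<rho>, of "U21 (V12 y)" "U22 (V y)"] by simp
    with M show ?thesis by metis
  qed
  have F: "finite F" "\<And>\<psi>. \<psi> \<in> F \<Longrightarrow> Vector_Spaces.linear sY (*) \<psi>"
  proof -
    show "finite F" by (simp add: F_def)
    fix \<psi> assume "\<psi> \<in> F"
    then obtain i where "\<psi> = (\<lambda>y. ipX (V12 y) (e i))" by (auto simp: F_def)
    moreover have "operator sY (*) (\<lambda>y. ipX (V12 y) (e i))"
      using e(1) by (intro operator_compose[OF X.operator_ip ops(6)]) (auto simp: X.orthonormal_def)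
    ultimately show "Vector_Spaces.linear sY (*) \<psi>"
      using operator_iff_linear[OF Y banach_space_field] by blast
  qed
  obtain n :: nat and \<phi> a where \<phi>: "\<And>i. operator sY (*) (\<phi> i)"
    and \<rho>_eq: "\<And>y. \<rho> y = (\<Sum>i<n. sY (\<phi> i y) (a i))"
    using Y.obtain_finite_rank_representation[OF \<rho> \<rho>\<rho> F below noV] by metis
  obtain N where N: "N > 0" "\<And>y. norm (U22 y) \<le> N * norm y"
    using operator_bound[OF ops(4)] by blast
  define r where "r = N + 1"
  define J where "J y = r *\<^sub>R y + U22 y" for y
  have J: "invertible_operator sY sY J"
    unfolding J_def using N by (intro invertible_scaleR_plus[OF Y ops(4)]) (auto simp: r_def)
  have sumr: "(\<Sum>i<n. sY (\<phi> i y) (r *\<^sub>R a i)) = r *\<^sub>R \<rho> y" for y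
    by (simp add: \<rho>_eq scaleR_sum_right banach_space_scaleR[OF Y])
  have U21r: "U21 (r *\<^sub>R x) = r *\<^sub>R U21 x" for x
    by (rule operator_scaleR_commute[OF ops(3) X Y])
  have J_eq: "J y - r *\<^sub>R \<rho> y = U22 y + U21 (r *\<^sub>R R y)" for y
    by (simp add: J_def \<rho>_def U21r algebra_simps)
  have "\<exists>x z. y = U21 x + (J z - (\<Sum>i<n. sY (\<phi> i z) (r *\<^sub>R a i)))" for y
  proof -
    have "y = U21 (V12 y - r *\<^sub>R R (V y)) + (J (V y) - r *\<^sub>R \<rho> (V y))"
      unfolding J_eq using UV(4)[of y] by (simp add: operator_diff[OF ops(3)] add.commute)
    then show ?thesis unfolding sumr by blast
  qed
  then obtain T where T: "operator sY sX T"
    and inv: "invertible_operator sY sY (\<lambda>y. J y - (\<Sum>i<n. sY (\<phi> i y) (r *\<^sub>R a i)) + U21 (T y))"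
    using obtain_invertible_completion[OF X Y ops(3) J, of n \<phi> "\<lambda>i. r *\<^sub>R a i"] \<phi> by blast
  show ?thesis
  proof (rule schur_coupled_if_shifted_corner_invertible)
    show "operator sX sY (\<lambda>x. 0)" by (rule operator_const_zero[OF X Y])
    show "operator sY sX (\<lambda>y. r *\<^sub>R R y + T y)"
      by (intro operator_plus[OF Y X] operator_scaleR[OF Y X] R T)
    show "invertible_operator sY sY (\<lambda>y. U22 y + 0 + U21 (r *\<^sub>R R y + T y) + 0)"
      using inv unfolding sumr J_eq by (simp add: operator_add[OF ops(3)] add.assoc)
  qed
qed

lemma schur_coupled_if_matricially_coupled:
  assumes X: "separable_hilbert_space sX ipX" and Y: "separable_hilbert_space sY ipY"
    and "matricially_coupled sX sY U V"
  shows "schur_coupled sX sY U V"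
proof -
  interpret X: separable_hilbert_space sX ipX by (rule X)
  interpret Y: separable_hilbert_space sY ipY by (rule Y)
  obtain U12 U21 U22 V11 V12 V21 where c: "coupling sX sY U U12 U21 U22 V11 V12 V21 V"
    using assms(3) matricially_coupled_iff[OF X.banach Y.banach] by blast
  consider f where "X.orthonormal UNIV f" "\<And>n. norm (f n) = 1" "X.bounded_below_on_sequence U f"
    | f where "Y.orthonormal UNIV f" "\<And>n. norm (f n) = 1" "Y.bounded_below_on_sequence V f"
    | "\<And>f. X.orthonormal UNIV f \<Longrightarrow> (\<And>n. norm (f n) = 1) \<Longrightarrow> \<not> X.bounded_below_on_sequence U f"
      "\<And>f. Y.orthonormal UNIV f \<Longrightarrow> (\<And>n. norm (f n) = 1) \<Longrightarrow> \<not> Y.bounded_below_on_sequence V f"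
    by blast
  then show ?thesis
  proof cases
    case 1
    then show ?thesis
      by (rule coupling.schur_coupled_if_bounded_below[OF c X.hilbert_space_axioms Y])
  next
    case 2
    have "schur_coupled sY sX V U"
      by (rule coupling.schur_coupled_if_bounded_below[OF coupling.swap[OF c] Y.hilbert_space_axioms X 2])
    then show ?thesis
      by (rule schur_coupled_sym[OF Y.banach X.banach])
  next
    case 3
    then show ?thesis
      by (rule coupling.schur_coupled_if_not_bounded_below[OF c X Y.hilbert_space_axioms])
  qed
qed

(* Z is an arbitrary Banach space, so in the extension spaces X0, Y0 (closed subspaces of
   X + Y + Z) every pair of Banach spaces is covered: take Z to be their direct sum. *)

theorem theorem1p2:
  fixes sX :: "'k::real_or_complex \<Rightarrow> 'x::banach \<Rightarrow> 'x" and ipX :: "'x \<Rightarrow> 'x \<Rightarrow> 'k"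
    and sY :: "'k \<Rightarrow> 'y::banach \<Rightarrow> 'y" and ipY :: "'y \<Rightarrow> 'y \<Rightarrow> 'k"
    and sZ :: "'k \<Rightarrow> 'z::banach \<Rightarrow> 'z"
    and U :: "'x \<Rightarrow> 'x" and V :: "'y \<Rightarrow> 'y"
  assumes "separable_hilbert_space sX ipX" and "separable_hilbert_space sY ipY"
    and "banach_space sZ"
    and "operator sX sX U" and "operator sY sY V"
  shows "(schur_coupled sX sY U V \<longleftrightarrow> matricially_coupled sX sY U V) \<and>
         (matricially_coupled sX sY U V \<longleftrightarrow>
            equivalent_after_extension (sX \<oplus>\<^sub>s sY \<oplus>\<^sub>s sZ) sX sY U V)"
proof -
  interpret X: separable_hilbert_space sX ipX by (rule assms)
  interpret Y: separable_hilbert_space sY ipY by (rule assms)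
  note W = banach_space_dsum[OF X.banach banach_space_dsum[OF Y.banach assms(3)]]
  have "schur_coupled sX sY U V \<longleftrightarrow> matricially_coupled sX sY U V"
    using matricially_coupled_if_schur_coupled[OF X.banach Y.banach]
      schur_coupled_if_matricially_coupled[OF assms(1,2)] by blast
  moreover have "matricially_coupled sX sY U V \<longleftrightarrow>
      equivalent_after_extension (sX \<oplus>\<^sub>s sY \<oplus>\<^sub>s sZ) sX sY U V"
  proof
    assume "matricially_coupled sX sY U V"
    then obtain U12 U21 U22 V11 V12 V21 where "coupling sX sY U U12 U21 U22 V11 V12 V21 V"
      using matricially_coupled_iff[OF X.banach Y.banach] by blast
    then show "equivalent_after_extension (sX \<oplus>\<^sub>s sY \<oplus>\<^sub>s sZ) sX sY U V"
      by (rule coupling.equivalent_after_extension[OF _ assms(3)])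
  next
    assume "equivalent_after_extension (sX \<oplus>\<^sub>s sY \<oplus>\<^sub>s sZ) sX sY U V"
    then show "matricially_coupled sX sY U V"
      by (rule matricially_coupled_if_equivalent_after_extension[OF X.banach Y.banach W assms(4,5)])
  qed
  ultimately show ?thesis by blast
qed

end
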